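(* Let $k\ge1$ be an integer, let $T$ be a tree and let $\Gamma$ be a subgroup of $\mathrm{Aut}(T)$ whose action on $T$ is $k$-acylindrical. Then the quotient geodesic transformation $\varphi:\Gamma\backslash\mathcal{G}T\to\Gamma\backslash\mathcal{G}T$ is topologically conjugate to a subshift. More precisely, if $(\Sigma'_0,\sigma)$ is the geodesic flow of order $k$ of the quotient graph of groups $\Gamma\backslash\!\backslash T$, then there exists a homeomorphism $\theta':\Gamma\backslash\mathcal{G}T\to\Sigma'_0$ such that $\theta'\circ\varphi=\sigma\circ\theta'$.
   Context: $T$ is any simplicial tree (not necessarily locally finite) with its weak topology; $\mathrm{Aut}(T)$ is its group of automorphisms without inversion ($\Gamma$ is not assumed discrete). The action of $\Gamma$ on $T$ is $k$-acylindrical if the pointwise stabilizer in $\Gamma$ of any (locally) injective path of $k$ consecutive edges is trivial. $\mathcal{G}T$ is the space of injective simplicial maps $f:\mathbb{R}\to T$ ($\mathbb{R}$ with vertex set $\mathbb{Z}$), with the compact-open topology; $\Gamma$ acts by post-composition, and $\Gamma\backslash\mathcal{G}T$ has the quotient topology. $\varphi$ is induced by $f\mapsto\{t\mapsto f(t+1)\}$. For an edge $e$ of a graph, $o(e),t(e),\overline e$ denote its origin, terminal vertex and opposite edge. A graph of groups $(X,G_* )$ consists of a connected graph $X$ (vertex set $VX$, oriented edge set $EX$), groups $G_v$ ($v\in VX$), groups $G_e=G_{\overline e}$ ($e\in EX$), and injective morphisms $\rho_e:G_e\to G_{t(e)}$. The quotient graph of groups $\Gamma\backslash\!\backslash T$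 has underlying graph $X=\Gamma\backslash T$; choose lifts $\widetilde v,\widetilde e$ in $T$ of each vertex $v$ and edge $e$ of $X$, with $\overline{\widetilde e}=\widetilde{\overline e}$, and elements $g_e\in\Gamma$ with $g_e\,\widetilde{t(e)}=t(\widetilde e)$; then $G_v,G_e$ are the stabilizers in $\Gamma$ of $\widetilde v,\widetilde e$, and $\rho_e(h)=g_e^{-1}hg_e$. It is independent of choices up to isomorphism. Geodesic flow of order $k$ on $(X,G_* )$. A $k$-path is a sequence $(e_0,\dots,e_k)$ of edges with $t(e_{i-1})=o(e_i)$ for $1\le i\le k$. The group $G_{e_0}\times\dots\times G_{e_k}$ acts on $G_{o(e_1)}\times\dots\times G_{o(e_k)}$ by $$(\alpha_0,\dots,\alpha_k)\cdot(g_1,\dots,g_k)=\big(\rho_{e_0}(\alpha_0)\,g_1\,\rho_{\overline{e_1}}(\alpha_1^{-1}),\dots,\rho_{e_{k-1}}(\alpha_{k-1})\,g_k\,\rho_{\overline{e_k}}(\alpha_k^{-1})\big).$$ Let $G(e_0,\dots,e_k)$ be the quotient set and $[g_1,\dots,g_k]$ the class of $(g_1,\dots,g_k)$. The maps $(g_1,\dots,g_k)\mapsto(g_2,\dots,g_k)$ and $(g_1,\dots,g_k)\mapsto(g_1,\dots,g_{k-1})$ (if $k\ge2$), and $(g_1,\dots,g_k)\mapsto g_k$, induce maps $\mathrm{pr}_1:G(e_0,\dots,e_k)\to G(e_1,\dots,e_k)$, $\mathrm{pr}_2:G(e_0,\dots,e_k)\to G(e_0,\dots,e_{k-1})$ and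 $\mathrm{pr}_3:G(e_0,\dots,e_k)\to G(e_{k-1},e_k)=\rho_{e_{k-1}}(G_{e_{k-1}})\backslash G_{o(e_k)}/\rho_{\overline{e_k}}(G_{e_k})$. Let $\Omega'$ be the disjoint union of the sets $G(e_0,\dots,e_k)$ over all $k$-paths; give $\Omega'\times EX$ the discrete topology and $\Sigma'=(\Omega'\times EX)^{\mathbb{Z}}$ the product topology, and let $\sigma$ be the left shift. $\Sigma'_0\subset\Sigma'$ is the set of sequences $([g_{i,1},\dots,g_{i,k}],e_i)_{i\in\mathbb{Z}}$ such that for every $i\in\mathbb{Z}$: (1') $o(e_i)=t(e_{i-1})$; (2') $[g_{i,1},\dots,g_{i,k}]\in G(e_{i-k},\dots,e_{i-1},e_i)$; (3') $\mathrm{pr}_1([g_{i,1},\dots,g_{i,k}])=\mathrm{pr}_2([g_{i+1,1},\dots,g_{i+1,k}])$ (void if $k=1$); (4') if $e_i=\overline{e_{i-1}}$, then $\mathrm{pr}_3([g_{i,1},\dots,g_{i,k}])$ is not the trivial double coset $\rho_{\overline{e_i}}(G_{e_i})$. The geodesic flow of order $k$ on $(X,G_* )$ is the subshift $(\Sigma'_0,\sigma)$ (its alphabet may be infinite). *)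

theory Defs
  imports "HOL-Analysis.Analysis" "HOL-Algebra.Group_Action"
begin

section \<open>Graphs and trees in the sense of Serre\<close>

text \<open>Edges are oriented, and every edge comes with its opposite.  Carriers are explicit
  sets, so that the tree reduced to one vertex is allowed.\<close>

record ('v, 'e) serre_graph =
  verts :: "'v set"
  edges :: "'e set"
  origin :: "'e \<Rightarrow> 'v"
  opposite :: "'e \<Rightarrow> 'e"

definition terminus :: "('v, 'e, 'm) serre_graph_scheme \<Rightarrow> 'e \<Rightarrow> 'v" where
  "terminus X e = origin X (opposite X e)"

definition serre_graph :: "('v, 'e, 'm) serre_graph_scheme \<Rightarrow> bool" where
  "serre_graph X \<longleftrightarrow>
     (\<forall>e \<in> edges X. origin X e \<in> verts X \<and> opposite X e \<in> edges X
        \<and> opposite X e \<noteq> e \<and> opposite X (opposite X e) = e)"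

definition edge_path :: "('v, 'e, 'm) serre_graph_scheme \<Rightarrow> 'e list \<Rightarrow> bool" where
  "edge_path X es \<longleftrightarrow>
     set es \<subseteq> edges X \<and> successively (\<lambda>e e'. terminus X e = origin X e') es"

text \<open>Absence of backtracking, i.e. local injectivity of the path.\<close>

definition reduced :: "('v, 'e, 'm) serre_graph_scheme \<Rightarrow> 'e list \<Rightarrow> bool" where
  "reduced X es \<longleftrightarrow> successively (\<lambda>e e'. e' \<noteq> opposite X e) es"

definition connected_graph :: "('v, 'e, 'm) serre_graph_scheme \<Rightarrow> bool" where
  "connected_graph X \<longleftrightarrow> verts X \<noteq> {} \<and>
     (\<forall>u \<in> verts X. \<forall>v \<in> verts X. u = v \<or>
        (\<exists>es. edge_path X es \<and> es \<noteq> [] \<and> origin X (hd es) = u \<and> terminus X (last es) = v))"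

definition circuit :: "('v, 'e, 'm) serre_graph_scheme \<Rightarrow> 'e list \<Rightarrow> bool" where
  "circuit X es \<longleftrightarrow> es \<noteq> [] \<and> edge_path X es \<and> reduced X es
     \<and> terminus X (last es) = origin X (hd es) \<and> distinct (map (origin X) es)"

definition tree :: "('v, 'e, 'm) serre_graph_scheme \<Rightarrow> bool" where
  "tree X \<longleftrightarrow> serre_graph X \<and> connected_graph X \<and> (\<nexists>es. circuit X es)"


section \<open>Geometric realization with the weak topology\<close>

text \<open>Points of the realization are given by their barycentric coordinates.  This is the
  realization of a graph without loops or multiple edges, in particular of a tree.\<close>

definition simplices :: "('v, 'e, 'm) serre_graph_scheme \<Rightarrow> 'v set set" where
  "simplices X = (\<lambda>v. {v}) ` verts X \<union> (\<lambda>e. {origin X e, terminus X e}) ` edges X"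

definition cell :: "'v set \<Rightarrow> ('v \<Rightarrow> real) set" where
  "cell s = {x. (\<forall>v. 0 \<le> x v) \<and> (\<forall>v. v \<notin> s \<longrightarrow> x v = 0) \<and> sum x s = 1}"

definition vertex_point :: "'v \<Rightarrow> 'v \<Rightarrow> real" where
  "vertex_point v = (\<lambda>w. if w = v then 1 else 0)"

text \<open>Each cell lies in a finite-dimensional coordinate subspace, on which the product topology
  of the function type is the Euclidean one.\<close>

definition realization :: "('v, 'e, 'm) serre_graph_scheme \<Rightarrow> ('v \<Rightarrow> real) topology" where
  "realization X = topology (\<lambda>U. U \<subseteq> (\<Union>s \<in> simplices X. cell s)
     \<and> (\<forall>s \<in> simplices X. openin (top_of_set (cell s)) (U \<inter> cell s)))"

lemma openin_realization:
  "openin (realization X) U \<longleftrightarrow> U \<subseteq> (\<Union>s \<in> simplices X. cell s)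
     \<and> (\<forall>s \<in> simplices X. openin (top_of_set (cell s)) (U \<inter> cell s))"
proof -
  have "istopology (\<lambda>U. U \<subseteq> (\<Union>s \<in> simplices X. cell s)
     \<and> (\<forall>s \<in> simplices X. openin (top_of_set (cell s)) (U \<inter> cell s)))"
    unfolding istopology_def
  proof (intro conjI allI impI; (elim conjE)?)
    fix S U :: "('a \<Rightarrow> real) set"
    assume "S \<subseteq> (\<Union>s \<in> simplices X. cell s)"
    then show "S \<inter> U \<subseteq> (\<Union>s \<in> simplices X. cell s)" by blast
  next
    fix S U :: "('a \<Rightarrow> real) set"
    assume S: "\<forall>s\<in>simplices X. openin (top_of_set (cell s)) (S \<inter> cell s)"
      and U: "\<forall>s\<in>simplices X. openin (top_of_set (cell s)) (U \<inter> cell s)"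
    show "\<forall>s\<in>simplices X. openin (top_of_set (cell s)) (S \<inter> U \<inter> cell s)"
    proof
      fix s assume s: "s \<in> simplices X"
      have eq: "S \<inter> U \<inter> cell s = (S \<inter> cell s) \<inter> (U \<inter> cell s)" by blast
      show "openin (top_of_set (cell s)) (S \<inter> U \<inter> cell s)"
        unfolding eq by (rule openin_Int[OF bspec[OF S s] bspec[OF U s]])
    qed
  next
    fix K :: "('a \<Rightarrow> real) set set"
    assume K: "\<forall>U\<in>K. U \<subseteq> (\<Union>s \<in> simplices X. cell s)
     \<and> (\<forall>s \<in> simplices X. openin (top_of_set (cell s)) (U \<inter> cell s))"
    show "\<Union> K \<subseteq> (\<Union>s \<in> simplices X. cell s)"
      by (rule Union_least) (rule conjunct1[OF bspec[OF K]])
    show "\<forall>s\<in>simplices X. openin (top_of_set (cell s)) (\<Union> K \<inter> cell s)"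
    proof
      fix s assume s: "s \<in> simplices X"
      have "openin (top_of_set (cell s)) (U \<inter> cell s)" if "U \<in> K" for U
        by (rule bspec[OF conjunct2[OF bspec[OF K that]] s])
      then have "openin (top_of_set (cell s)) (\<Union>((\<lambda>U. U \<inter> cell s) ` K))"
        by (intro openin_Union) (elim imageE, simp only:)
      moreover have "\<Union>((\<lambda>U. U \<inter> cell s) ` K) = \<Union>K \<inter> cell s" by blast
      ultimately show "openin (top_of_set (cell s)) (\<Union>K \<inter> cell s)" by (simp only:)
    qed
  qed
  then show ?thesis
    unfolding realization_def by (simp only: topology_inverse')
qed


section \<open>Function space and quotient topologies\<close>

definition compact_open_topology ::
    "'b topology \<Rightarrow> ('a::topological_space \<Rightarrow> 'b) topology" where
  "compact_open_topology Y = topology_generated_by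
     {{f. continuous_map euclidean Y f \<and> f ` K \<subseteq> U} | K U. compact K \<and> openin Y U}"

definition quotient_topology :: "'a topology \<Rightarrow> ('a \<Rightarrow> 'b) \<Rightarrow> 'b topology" where
  "quotient_topology X q = topology (\<lambda>U. U \<subseteq> q ` topspace X
     \<and> openin X {x \<in> topspace X. q x \<in> U})"

lemma openin_quotient_topology:
  "openin (quotient_topology X q) U \<longleftrightarrow>
     U \<subseteq> q ` topspace X \<and> openin X {x \<in> topspace X. q x \<in> U}"
proof -
  have "istopology (\<lambda>U. U \<subseteq> q ` topspace X \<and> openin X {x \<in> topspace X. q x \<in> U})"
    unfolding istopology_def
  proof (intro conjI allI impI; (elim conjE)?)
    fix S U
    assume "S \<subseteq> q ` topspace X"
    then show "S \<inter> U \<subseteq> q ` topspace X" by blast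
  next
    fix S U
    assume "openin X {x \<in> topspace X. q x \<in> S}" "openin X {x \<in> topspace X. q x \<in> U}"
    then have "openin X ({x \<in> topspace X. q x \<in> S} \<inter> {x \<in> topspace X. q x \<in> U})"
      by (rule openin_Int)
    moreover have "{x \<in> topspace X. q x \<in> S} \<inter> {x \<in> topspace X. q x \<in> U}
        = {x \<in> topspace X. q x \<in> S \<inter> U}" by auto
    ultimately show "openin X {x \<in> topspace X. q x \<in> S \<inter> U}" by simp
  next
    fix K assume K: "\<forall>U\<in>K. U \<subseteq> q ` topspace X \<and> openin X {x \<in> topspace X. q x \<in> U}"
    then show "\<Union>K \<subseteq> q ` topspace X" by blast
    have "openin X (\<Union>U\<in>K. {x \<in> topspace X. q x \<in> U})"
      using K by (intro openin_Union) auto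
    moreover have "(\<Union>U\<in>K. {x \<in> topspace X. q x \<in> U}) = {x \<in> topspace X. q x \<in> \<Union>K}"
      by auto
    ultimately show "openin X {x \<in> topspace X. q x \<in> \<Union>K}" by simp
  qed
  then show ?thesis
    unfolding quotient_topology_def by (simp only: topology_inverse')
qed


section \<open>Groups of automorphisms\<close>

definition graph_aut ::
    "('v, 'e, 'm) serre_graph_scheme \<Rightarrow> (('v \<Rightarrow> 'v) \<times> ('e \<Rightarrow> 'e)) monoid" where
  "graph_aut X = (BijGroup (verts X) \<times>\<times> BijGroup (edges X))
     \<lparr>carrier := {(a, b). a \<in> Bij (verts X) \<and> b \<in> Bij (edges X)
        \<and> (\<forall>e \<in> edges X. origin X (b e) = a (origin X e)
                          \<and> opposite X (b e) = b (opposite X e))}\<rparr>"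

definition without_inversion ::
    "('v, 'e, 'm) serre_graph_scheme \<Rightarrow> (('v \<Rightarrow> 'v) \<times> ('e \<Rightarrow> 'e)) set \<Rightarrow> bool" where
  "without_inversion X \<Gamma> \<longleftrightarrow> (\<forall>g \<in> \<Gamma>. \<forall>e \<in> edges X. snd g e \<noteq> opposite X e)"

definition aut_subgroup ::
    "('v, 'e, 'm) serre_graph_scheme \<Rightarrow> (('v \<Rightarrow> 'v) \<times> ('e \<Rightarrow> 'e)) set
      \<Rightarrow> (('v \<Rightarrow> 'v) \<times> ('e \<Rightarrow> 'e)) monoid" where
  "aut_subgroup X \<Gamma> = (graph_aut X)\<lparr>carrier := \<Gamma>\<rparr>"

definition acylindrical ::
    "nat \<Rightarrow> ('v, 'e, 'm) serre_graph_scheme \<Rightarrow> (('v \<Rightarrow> 'v) \<times> ('e \<Rightarrow> 'e)) set \<Rightarrow> bool" where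
  "acylindrical k X \<Gamma> \<longleftrightarrow>
     (\<forall>es. edge_path X es \<and> reduced X es \<and> length es = k \<longrightarrow>
        {g \<in> \<Gamma>. \<forall>e \<in> set es. snd g e = e} = {\<one>\<^bsub>graph_aut X\<^esub>})"


section \<open>The space of geodesics and its quotient\<close>

text \<open>Simplicial maps from the real line, with vertex set the integers: vertices go to vertices,
  edges go into simplices, and the map is affine on each edge.\<close>

definition simplicial_line :: "('v, 'e, 'm) serre_graph_scheme \<Rightarrow> (real \<Rightarrow> 'v \<Rightarrow> real) \<Rightarrow> bool" where
  "simplicial_line X f \<longleftrightarrow> (\<forall>n::int.
     f (of_int n) \<in> vertex_point ` verts X
     \<and> (\<exists>s \<in> simplices X. f (of_int n) \<in> cell s \<and> f (of_int (n + 1)) \<in> cell s)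
     \<and> (\<forall>u \<in> {0..1}. f (of_int n + u) =
           (\<lambda>v. (1 - u) * f (of_int n) v + u * f (of_int (n + 1)) v)))"

definition geodesics :: "('v, 'e, 'm) serre_graph_scheme \<Rightarrow> (real \<Rightarrow> 'v \<Rightarrow> real) topology" where
  "geodesics X =
     subtopology (compact_open_topology (realization X)) {f. simplicial_line X f \<and> inj f}"

text \<open>Affine extension of an automorphism to the realization: the coordinate of a point at
  \<open>v\<close> becomes the coordinate of its image at the image of \<open>v\<close>.\<close>

definition realize_aut ::
    "('v, 'e, 'm) serre_graph_scheme \<Rightarrow> ('v \<Rightarrow> 'v) \<times> ('e \<Rightarrow> 'e) \<Rightarrow> ('v \<Rightarrow> real) \<Rightarrow> 'v \<Rightarrow> real" where
  "realize_aut X g x = (\<lambda>w. if w \<in> verts X then x (inv_into (verts X) (fst g) w) else 0)"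

definition geodesic_orbit ::
    "('v, 'e, 'm) serre_graph_scheme \<Rightarrow> (('v \<Rightarrow> 'v) \<times> ('e \<Rightarrow> 'e)) set
      \<Rightarrow> (real \<Rightarrow> 'v \<Rightarrow> real) \<Rightarrow> (real \<Rightarrow> 'v \<Rightarrow> real) set" where
  "geodesic_orbit X \<Gamma> = orbit (aut_subgroup X \<Gamma>) (\<lambda>g f. realize_aut X g \<circ> f)"

definition geodesics_quotient ::
    "('v, 'e, 'm) serre_graph_scheme \<Rightarrow> (('v \<Rightarrow> 'v) \<times> ('e \<Rightarrow> 'e)) set
      \<Rightarrow> (real \<Rightarrow> 'v \<Rightarrow> real) set topology" where
  "geodesics_quotient X \<Gamma> = quotient_topology (geodesics X) (geodesic_orbit X \<Gamma>)"

text \<open>The map induced on orbits, as the direct image of an orbit.\<close>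

definition geodesic_transformation ::
    "(real \<Rightarrow> 'v \<Rightarrow> real) set \<Rightarrow> (real \<Rightarrow> 'v \<Rightarrow> real) set" where
  "geodesic_transformation c = (\<lambda>f t. f (t + 1)) ` c"


section \<open>Graphs of groups\<close>

record ('v, 'e, 'a, 'b) graph_of_groups = "('v, 'e) serre_graph" +
  vgroup :: "'v \<Rightarrow> 'a monoid"
  egroup :: "'e \<Rightarrow> 'b monoid"
  emb :: "'e \<Rightarrow> 'b \<Rightarrow> 'a"

definition graph_of_groups :: "('v, 'e, 'a, 'b) graph_of_groups \<Rightarrow> bool" where
  "graph_of_groups X \<longleftrightarrow> serre_graph X \<and> connected_graph X
     \<and> (\<forall>v \<in> verts X. group (vgroup X v))
     \<and> (\<forall>e \<in> edges X. group (egroup X e) \<and> egroup X (opposite X e) = egroup X e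
          \<and> emb X e \<in> hom (egroup X e) (vgroup X (terminus X e))
          \<and> inj_on (emb X e) (carrier (egroup X e)))"

text \<open>The vertices and edges of the quotient are orbits; its structure maps are induced by those
  of the covering graph, as direct images of orbits.\<close>

definition quotient_graph ::
    "('v, 'e, 'm) serre_graph_scheme \<Rightarrow> (('v \<Rightarrow> 'v) \<times> ('e \<Rightarrow> 'e)) set
      \<Rightarrow> ('v set, 'e set) serre_graph" where
  "quotient_graph T \<Gamma> =
     \<lparr>verts = orbits (aut_subgroup T \<Gamma>) (verts T) fst,
      edges = orbits (aut_subgroup T \<Gamma>) (edges T) snd,
      origin = (\<lambda>c. origin T ` c),
      opposite = (\<lambda>c. opposite T ` c)\<rparr>"

text \<open>The choices entering the quotient graph of groups: \<open>liftv\<close> and \<open>lifte\<close> lift the vertices and edges,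
  and \<open>gel\<close> picks the group elements.\<close>

definition lift_choice ::
    "('v, 'e, 'm) serre_graph_scheme \<Rightarrow> (('v \<Rightarrow> 'v) \<times> ('e \<Rightarrow> 'e)) set
      \<Rightarrow> ('v set \<Rightarrow> 'v) \<Rightarrow> ('e set \<Rightarrow> 'e) \<Rightarrow> ('e set \<Rightarrow> ('v \<Rightarrow> 'v) \<times> ('e \<Rightarrow> 'e)) \<Rightarrow> bool" where
  "lift_choice T \<Gamma> liftv lifte gel \<longleftrightarrow>
     (\<forall>v \<in> verts (quotient_graph T \<Gamma>). liftv v \<in> v)
     \<and> (\<forall>e \<in> edges (quotient_graph T \<Gamma>).
          lifte e \<in> e
          \<and> opposite T (lifte e) = lifte (opposite (quotient_graph T \<Gamma>) e)
          \<and> gel e \<in> \<Gamma>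
          \<and> fst (gel e) (liftv (terminus (quotient_graph T \<Gamma>) e)) = terminus T (lifte e))"

definition quotient_graph_of_groups ::
    "('v, 'e, 'm) serre_graph_scheme \<Rightarrow> (('v \<Rightarrow> 'v) \<times> ('e \<Rightarrow> 'e)) set
      \<Rightarrow> ('v set \<Rightarrow> 'v) \<Rightarrow> ('e set \<Rightarrow> 'e) \<Rightarrow> ('e set \<Rightarrow> ('v \<Rightarrow> 'v) \<times> ('e \<Rightarrow> 'e))
      \<Rightarrow> ('v set, 'e set, ('v \<Rightarrow> 'v) \<times> ('e \<Rightarrow> 'e), ('v \<Rightarrow> 'v) \<times> ('e \<Rightarrow> 'e)) graph_of_groups" where
  "quotient_graph_of_groups T \<Gamma> liftv lifte gel =
     (let G = aut_subgroup T \<Gamma>; X = quotient_graph T \<Gamma> in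
     \<lparr>verts = verts X,
      edges = edges X,
      origin = origin X,
      opposite = opposite X,
      vgroup = (\<lambda>v. G\<lparr>carrier := stabilizer G fst (liftv v)\<rparr>),
      egroup = (\<lambda>e. G\<lparr>carrier := stabilizer G snd (lifte e)\<rparr>),
      emb = (\<lambda>e h. inv\<^bsub>G\<^esub> (gel e) \<otimes>\<^bsub>G\<^esub> h \<otimes>\<^bsub>G\<^esub> gel e)\<rparr>)"


lemma group_graph_aut:
  assumes X: "serre_graph X"
  shows "group (graph_aut X)"
proof -
  let ?V = "verts X" and ?E = "edges X"
  let ?D = "BijGroup ?V \<times>\<times> BijGroup ?E"
  let ?C = "{(a, b). a \<in> Bij ?V \<and> b \<in> Bij ?E
        \<and> (\<forall>e \<in> ?E. origin X (b e) = a (origin X e)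
                          \<and> opposite X (b e) = b (opposite X e))}"
  interpret D: group ?D by (intro DirProd_group group_BijGroup)
  have "subgroup ?C ?D"
  proof (rule D.subgroupI)
    show "?C \<subseteq> carrier ?D" by (auto simp: DirProd_def BijGroup_def)
    have "((\<lambda>x\<in>?V. x), (\<lambda>x\<in>?E. x)) \<in> ?C"
      using X by (auto simp: id_Bij serre_graph_def)
    then show "?C \<noteq> {}" by blast
  next
    fix g assume g: "g \<in> ?C"
    obtain a b where ab: "g = (a, b)" by force
    have a: "a \<in> Bij ?V" and b: "b \<in> Bij ?E" using g ab by auto
    have bij: "bij_betw a ?V ?V" "bij_betw b ?E ?E" using a b by (auto simp: Bij_def)
    have inv: "inv\<^bsub>?D\<^esub> g = (restrict (inv_into ?V a) ?V, restrict (inv_into ?E b) ?E)"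
      unfolding ab using a b
      by (subst inv_DirProd) (auto simp: group_BijGroup inv_BijGroup, auto simp: BijGroup_def)
    have "origin X (inv_into ?E b e) = inv_into ?V a (origin X e)
        \<and> opposite X (inv_into ?E b e) = inv_into ?E b (opposite X e)" if e: "e \<in> ?E" for e
    proof -
      define e' where "e' = inv_into ?E b e"
      have e': "e' \<in> ?E" "b e' = e"
        using e bij(2) by (auto simp: e'_def bij_betw_def inv_into_into f_inv_into_f)
      have "origin X e = a (origin X e')" "opposite X e = b (opposite X e')"
        using g ab e' by auto
      moreover have "origin X e' \<in> ?V" "opposite X e' \<in> ?E"
        using X e' by (auto simp: serre_graph_def)
      ultimately show ?thesis
        using bij by (simp add: e'_def[symmetric] bij_betw_def)
    qed
    then show "inv\<^bsub>?D\<^esub> g \<in> ?C"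
      using X a b by (auto simp: inv restrict_inv_into_Bij serre_graph_def)
  next
    fix g h assume gh: "g \<in> ?C" "h \<in> ?C"
    obtain a b c d where ab: "g = (a, b)" "h = (c, d)" by (metis surj_pair)
    have "d e \<in> ?E" if "e \<in> ?E" for e
      using gh ab that by (auto simp: Bij_def bij_betw_def)
    then show "g \<otimes>\<^bsub>?D\<^esub> h \<in> ?C"
      using gh X ab by (auto simp: DirProd_def BijGroup_def compose_Bij compose_eq serre_graph_def)
  qed
  then show ?thesis
    unfolding graph_aut_def by (rule D.subgroup_imp_group)
qed

lemma aut_subgroup_actions:
  assumes X: "serre_graph X" and \<Gamma>: "subgroup \<Gamma> (graph_aut X)"
  shows "group_action (aut_subgroup X \<Gamma>) (verts X) fst"
    and "group_action (aut_subgroup X \<Gamma>) (edges X) snd"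
proof -
  have G: "group (aut_subgroup X \<Gamma>)"
    unfolding aut_subgroup_def
    using group.subgroup_imp_group[OF group_graph_aut[OF X] \<Gamma>] .
  have sub: "\<Gamma> \<subseteq> carrier (graph_aut X)" using \<Gamma> by (rule subgroup.subset)
  have "fst \<in> hom (aut_subgroup X \<Gamma>) (BijGroup (verts X))"
    "snd \<in> hom (aut_subgroup X \<Gamma>) (BijGroup (edges X))"
    using sub unfolding hom_def aut_subgroup_def graph_aut_def
    by (auto simp: DirProd_def BijGroup_def)
  then show "group_action (aut_subgroup X \<Gamma>) (verts X) fst"
    "group_action (aut_subgroup X \<Gamma>) (edges X) snd"
    using G by (auto intro!: group_action.intro group_hom.intro group_hom_axioms.intro group_BijGroup)
qed

lemma aut_subgroup_equivariant:
  assumes "subgroup \<Gamma> (graph_aut X)" "g \<in> \<Gamma>" "e \<in> edges X"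
  shows "origin X (snd g e) = fst g (origin X e)"
    and "opposite X (snd g e) = snd g (opposite X e)"
  using subgroup.subset[OF assms(1)] assms(2,3) by (auto simp: graph_aut_def)

lemma origin_orbit:
  assumes "subgroup \<Gamma> (graph_aut X)" "e \<in> edges X"
  shows "origin X ` orbit (aut_subgroup X \<Gamma>) snd e = orbit (aut_subgroup X \<Gamma>) fst (origin X e)"
    and "opposite X ` orbit (aut_subgroup X \<Gamma>) snd e = orbit (aut_subgroup X \<Gamma>) snd (opposite X e)"
  using aut_subgroup_equivariant[OF assms(1) _ assms(2)]
  by (auto simp: orbit_def aut_subgroup_def image_iff) (metis+)

lemma graph_of_groups_quotient:
  assumes T: "serre_graph T" "connected_graph T"
    and \<Gamma>: "subgroup \<Gamma> (graph_aut T)" "without_inversion T \<Gamma>"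
    and lift: "lift_choice T \<Gamma> liftv lifte gel"
  shows "graph_of_groups (quotient_graph_of_groups T \<Gamma> liftv lifte gel)"
proof -
  define G where "G = aut_subgroup T \<Gamma>"
  define Q where "Q = quotient_graph T \<Gamma>"
  define Y where "Y = quotient_graph_of_groups T \<Gamma> liftv lifte gel"
  interpret V: group_action G "verts T" fst
    unfolding G_def by (rule aut_subgroup_actions[OF T(1) \<Gamma>(1)])
  interpret E: group_action G "edges T" snd
    unfolding G_def by (rule aut_subgroup_actions[OF T(1) \<Gamma>(1)])
  interpret G: group G using V.group_hom by (rule group_hom.axioms)
  have carr: "carrier G = \<Gamma>" by (simp add: G_def aut_subgroup_def)
  note equiv = aut_subgroup_equivariant[OF \<Gamma>(1)]
  have oe: "origin T e \<in> verts T" "opposite T e \<in> edges T" "terminus T e \<in> verts T"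
      "opposite T (opposite T e) = e"
    if "e \<in> edges T" for e
    using T(1) that by (auto simp: serre_graph_def terminus_def)
  have orb: "origin T ` orbit G snd e = orbit G fst (origin T e)"
      "opposite T ` orbit G snd e = orbit G snd (opposite T e)" if "e \<in> edges T" for e
    using origin_orbit[OF \<Gamma>(1) that] by (simp_all add: G_def)
  have Yv: "verts Y = orbits G (verts T) fst" and Ye: "edges Y = orbits G (edges T) snd"
    and Yo: "origin Y = (\<lambda>c. origin T ` c)" and Yopp: "opposite Y = (\<lambda>c. opposite T ` c)"
    by (simp_all add: Y_def quotient_graph_of_groups_def Let_def quotient_graph_def G_def)
  have Yt: "terminus Y (orbit G snd e) = orbit G fst (terminus T e)" if "e \<in> edges T" for e
    using that oe[OF that] by (simp add: terminus_def Yo Yopp orb)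
  have QY: "verts Q = verts Y" "edges Q = edges Y" "opposite Q = opposite Y" "terminus Q = terminus Y"
    by (auto simp: Q_def Y_def quotient_graph_of_groups_def Let_def terminus_def)
  have "serre_graph Y"
    unfolding serre_graph_def
  proof
    fix c assume "c \<in> edges Y"
    then obtain e where e: "e \<in> edges T" "c = orbit G snd e" by (auto simp: Ye orbits_def)
    have "opposite T e \<notin> c"
      using \<Gamma>(2) e unfolding orbit_def carr without_inversion_def by fastforce
    moreover have "opposite T e \<in> opposite Y c"
      using e oe[OF e(1)] orb[OF e(1)] by (simp add: Yopp E.orbit_refl)
    ultimately have "opposite Y c \<noteq> c" by blast
    then show "origin Y c \<in> verts Y \<and> opposite Y c \<in> edges Y \<and> opposite Y c \<noteq> c
        \<and> opposite Y (opposite Y c) = c"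
      using e oe[OF e(1)] orb oe by (auto simp: Yv Ye Yo Yopp orbits_def)
  qed
  moreover have "connected_graph Y"
    unfolding connected_graph_def
  proof (intro conjI ballI)
    show "verts Y \<noteq> {}" using T(2) by (auto simp: Yv orbits_def connected_graph_def)
    fix c d assume "c \<in> verts Y" "d \<in> verts Y"
    then obtain u v where uv: "u \<in> verts T" "v \<in> verts T" "c = orbit G fst u" "d = orbit G fst v"
      by (auto simp: Yv orbits_def)
    show "c = d \<or> (\<exists>es. edge_path Y es \<and> es \<noteq> [] \<and> origin Y (hd es) = c \<and> terminus Y (last es) = d)"
    proof (cases "u = v")
      case False
      then obtain es where es: "edge_path T es" "es \<noteq> []" "origin T (hd es) = u" "terminus T (last es) = v"
        using T(2) uv by (auto simp: connected_graph_def)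
      have sub: "set es \<subseteq> edges T" using es by (simp add: edge_path_def)
      let ?p = "map (orbit G snd) es"
      have "successively (\<lambda>e e'. terminus Y (orbit G snd e) = origin Y (orbit G snd e')) es"
      proof (rule successively_mono)
        show "successively (\<lambda>e e'. terminus T e = origin T e') es"
          using es(1) by (simp add: edge_path_def)
        fix e e' assume "e \<in> set es" "e' \<in> set es" "terminus T e = origin T e'"
        then show "terminus Y (orbit G snd e) = origin Y (orbit G snd e')"
          using sub orb(1)[of e'] Yt[of e] by (simp add: Yo subset_iff)
      qed
      then have "edge_path Y ?p"
        using sub by (auto simp: edge_path_def successively_map Ye orbits_def)
      moreover have "origin Y (hd ?p) = c" "terminus Y (last ?p) = d"
        using es(2-4) sub uv(3,4) orb(1)[of "hd es"] Yt[of "last es"]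
        by (simp_all add: hd_map last_map Yo subset_iff)
      ultimately show ?thesis using es(2) by blast
    qed (use uv in simp)
  qed
  moreover have grp: "group (vgroup Y c)" if c: "c \<in> verts Y" for c
  proof -
    have "liftv c \<in> verts T"
    proof -
      have "liftv c \<in> c" using lift c QY by (auto simp: lift_choice_def Q_def)
      moreover obtain v where "v \<in> verts T" "c = orbit G fst v" using c by (auto simp: Yv orbits_def)
      ultimately show ?thesis by (auto simp: orbit_def V.element_image)
    qed
    then have "subgroup (stabilizer G fst (liftv c)) G" by (rule V.stabilizer_subgroup)
    then show ?thesis
      by (simp add: Y_def quotient_graph_of_groups_def Let_def G.subgroup_imp_group flip: G_def)
  qed
  moreover have "group (egroup Y c) \<and> egroup Y (opposite Y c) = egroup Y c
          \<and> emb Y c \<in> hom (egroup Y c) (vgroup Y (terminus Y c))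
          \<and> inj_on (emb Y c) (carrier (egroup Y c))" if c: "c \<in> edges Y" for c
  proof -
    obtain e where e: "e \<in> edges T" "c = orbit G snd e" using c by (auto simp: Ye orbits_def)
    have l: "lifte c \<in> c" "opposite T (lifte c) = lifte (opposite Y c)" "gel c \<in> \<Gamma>"
      "fst (gel c) (liftv (terminus Y c)) = terminus T (lifte c)"
      using lift c QY by (auto simp: lift_choice_def Q_def)
    have le: "lifte c \<in> edges T" using l(1) e by (auto simp: orbit_def E.element_image)
    have tc: "terminus Y c \<in> verts Y" using e Yt oe by (auto simp: Yv orbits_def)
    have lv: "liftv (terminus Y c) \<in> verts T"
    proof -
      have "liftv (terminus Y c) \<in> terminus Y c" using lift tc QY by (auto simp: lift_choice_def Q_def)
      then have "liftv (terminus Y c) \<in> orbit G fst (terminus T e)" by (simp only: e(2) Yt[OF e(1)])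
      then show ?thesis using oe(3)[OF e(1)] by (auto simp: orbit_def V.element_image)
    qed
    have eg: "egroup Y c = G\<lparr>carrier := stabilizer G snd (lifte c)\<rparr>" for c
      by (simp add: Y_def quotient_graph_of_groups_def Let_def G_def)
    have vg: "vgroup Y c = G\<lparr>carrier := stabilizer G fst (liftv c)\<rparr>" for c
      by (simp add: Y_def quotient_graph_of_groups_def Let_def G_def)
    have em: "emb Y c = (\<lambda>h. inv\<^bsub>G\<^esub> (gel c) \<otimes>\<^bsub>G\<^esub> h \<otimes>\<^bsub>G\<^esub> gel c)"
      by (simp add: Y_def quotient_graph_of_groups_def Let_def G_def)
    have gc: "gel c \<in> carrier G" using l carr by simp
    have g1: "group (egroup Y c)"
      unfolding eg by (intro G.subgroup_imp_group E.stabilizer_subgroup le)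
    have st: "snd h (opposite T (lifte c)) = opposite T (lifte c) \<longleftrightarrow> snd h (lifte c) = lifte c"
      if "h \<in> \<Gamma>" for h
      using equiv(2)[OF that le] equiv(2)[OF that oe(2)[OF le]] oe(4)[OF le] by metis
    have g2: "egroup Y (opposite Y c) = egroup Y c"
      unfolding eg l(2)[symmetric] stabilizer_def carr by (simp add: st cong: conj_cong)
    have g3: "emb Y c \<in> hom (egroup Y c) (vgroup Y (terminus Y c))"
    proof (rule homI)
      fix h assume "h \<in> carrier (egroup Y c)"
      then have h: "h \<in> carrier G" "snd h (lifte c) = lifte c" by (auto simp: eg stabilizer_def)
      have "snd h (opposite T (lifte c)) = opposite T (lifte c)" using st h carr by auto
      then have "fst h (terminus T (lifte c)) = terminus T (lifte c)"
        using equiv(1)[of h "opposite T (lifte c)"] h carr oe(2)[OF le] by (simp add: terminus_def)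
      moreover have "fst (inv\<^bsub>G\<^esub> gel c) (terminus T (lifte c)) = liftv (terminus Y c)"
        using V.orbit_sym_aux[OF gc lv l(4)] .
      ultimately show "emb Y c h \<in> carrier (vgroup Y (terminus Y c))"
        using h gc lv l(4) oe(3)[OF le]
        by (simp add: em vg stabilizer_def V.composition_rule)
    next
      fix h k assume "h \<in> carrier (egroup Y c)" "k \<in> carrier (egroup Y c)"
      then have hk: "h \<in> carrier G" "k \<in> carrier G" by (auto simp: eg stabilizer_def)
      have "gel c \<otimes>\<^bsub>G\<^esub> (inv\<^bsub>G\<^esub> gel c \<otimes>\<^bsub>G\<^esub> (k \<otimes>\<^bsub>G\<^esub> gel c)) = k \<otimes>\<^bsub>G\<^esub> gel c"
        using hk gc by (simp flip: G.m_assoc)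
      then show "emb Y c (h \<otimes>\<^bsub>egroup Y c\<^esub> k) =
          emb Y c h \<otimes>\<^bsub>vgroup Y (terminus Y c)\<^esub> emb Y c k"
        using hk gc by (simp add: em eg vg G.m_assoc)
    qed
    have g4: "inj_on (emb Y c) (carrier (egroup Y c))"
    proof (rule inj_onI)
      fix h k assume "h \<in> carrier (egroup Y c)" "k \<in> carrier (egroup Y c)" "emb Y c h = emb Y c k"
      then show "h = k" using gc by (simp add: em eg stabilizer_def)
    qed
    show ?thesis using g1 g2 g3 g4 by (intro conjI)
  qed
  ultimately show ?thesis by (simp add: graph_of_groups_def Y_def)
qed


section \<open>Subshifts\<close>

definition full_shift :: "'x set \<Rightarrow> (int \<Rightarrow> 'x) topology" where
  "full_shift A = product_topology (\<lambda>_. discrete_topology A) UNIV"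

definition left_shift :: "(int \<Rightarrow> 'x) \<Rightarrow> int \<Rightarrow> 'x" where
  "left_shift s = (\<lambda>i. s (i + 1))"

definition subshift :: "'x set \<Rightarrow> (int \<Rightarrow> 'x) set \<Rightarrow> bool" where
  "subshift A S \<longleftrightarrow> closedin (full_shift A) S \<and> left_shift ` S = S"


section \<open>The geodesic flow of order k of a graph of groups\<close>

definition k_paths :: "nat \<Rightarrow> ('v, 'e, 'm) serre_graph_scheme \<Rightarrow> 'e list set" where
  "k_paths k X = {es. edge_path X es \<and> length es = k + 1}"

text \<open>For a path \<open>es\<close> with \<open>k + 1\<close> edges numbered from \<open>0\<close>, a tuple of vertex group elements
  numbered from \<open>1\<close> in the mathematical notation is a list \<open>gs\<close> of length \<open>k\<close>, so
  \<open>gs ! j\<close> is the element number \<open>j + 1\<close>.\<close>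

definition vertex_tuples :: "('v, 'e, 'a, 'b) graph_of_groups \<Rightarrow> 'e list \<Rightarrow> 'a list set" where
  "vertex_tuples X es = {gs. length gs + 1 = length es
     \<and> (\<forall>j < length gs. gs ! j \<in> carrier (vgroup X (origin X (es ! (j + 1)))))}"

definition edge_tuples :: "('v, 'e, 'a, 'b) graph_of_groups \<Rightarrow> 'e list \<Rightarrow> 'b list set" where
  "edge_tuples X es = {as. length as = length es
     \<and> (\<forall>j < length as. as ! j \<in> carrier (egroup X (es ! j)))}"

definition tuple_action ::
    "('v, 'e, 'a, 'b) graph_of_groups \<Rightarrow> 'e list \<Rightarrow> 'b list \<Rightarrow> 'a list \<Rightarrow> 'a list" where
  "tuple_action X es as gs = map (\<lambda>j.
     emb X (es ! j) (as ! j)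
       \<otimes>\<^bsub>vgroup X (origin X (es ! (j + 1)))\<^esub> gs ! j
       \<otimes>\<^bsub>vgroup X (origin X (es ! (j + 1)))\<^esub>
         emb X (opposite X (es ! (j + 1))) (inv\<^bsub>egroup X (es ! (j + 1))\<^esub> (as ! (j + 1))))
     [0..<length gs]"

definition tuple_class ::
    "('v, 'e, 'a, 'b) graph_of_groups \<Rightarrow> 'e list \<Rightarrow> 'a list \<Rightarrow> 'a list set" where
  "tuple_class X es gs = {tuple_action X es as gs | as. as \<in> edge_tuples X es}"

definition tuple_classes ::
    "('v, 'e, 'a, 'b) graph_of_groups \<Rightarrow> 'e list \<Rightarrow> 'a list set set" where
  "tuple_classes X es = tuple_class X es ` vertex_tuples X es"

text \<open>The projections, as direct images of classes.\<close>

definition pr1 :: "'a list set \<Rightarrow> 'a list set" where "pr1 C = tl ` C"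
definition pr2 :: "'a list set \<Rightarrow> 'a list set" where "pr2 C = butlast ` C"
definition pr3 :: "'a list set \<Rightarrow> 'a set" where "pr3 C = last ` C"

text \<open>A class is tagged by its path, which makes the union over all paths disjoint.\<close>

definition flow_alphabet ::
    "nat \<Rightarrow> ('v, 'e, 'a, 'b) graph_of_groups \<Rightarrow> (('e list \<times> 'a list set) \<times> 'e) set" where
  "flow_alphabet k X = (SIGMA es : k_paths k X. tuple_classes X es) \<times> edges X"

text \<open>The path formed by the edge letters with indices \<open>i - k, \<dots>, i\<close>.\<close>

definition edge_window :: "nat \<Rightarrow> (int \<Rightarrow> 'c \<times> 'e) \<Rightarrow> int \<Rightarrow> 'e list" where
  "edge_window k s i = map (\<lambda>j. snd (s (i - int k + int j))) [0..<k + 1]"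

definition geodesic_flow ::
    "nat \<Rightarrow> ('v, 'e, 'a, 'b) graph_of_groups
      \<Rightarrow> (int \<Rightarrow> ('e list \<times> 'a list set) \<times> 'e) set" where
  "geodesic_flow k X = {s \<in> topspace (full_shift (flow_alphabet k X)). \<forall>i.
     origin X (snd (s i)) = terminus X (snd (s (i - 1)))
     \<and> fst (s i) \<in> {edge_window k s i} \<times> tuple_classes X (edge_window k s i)
     \<and> (k \<ge> 2 \<longrightarrow> pr1 (snd (fst (s i))) = pr2 (snd (fst (s (i + 1)))))
     \<and> (snd (s i) = opposite X (snd (s (i - 1))) \<longrightarrow>
          pr3 (snd (fst (s i)))
            \<noteq> emb X (opposite X (snd (s i))) ` carrier (egroup X (snd (s i))))}"

end

theory Submission
  imports Defs
begin

text \<open>A geodesic is a reduced bi-infinite edge line \<open>f\<close> of the tree.  Choosing \<open>h\<^sub>i \<in> \<Gamma>\<close> that moves the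
  chosen lift of the orbit of \<open>f i\<close> to \<open>f i\<close>, the elements \<open>gel\<^sup>-\<^sup>1 h\<^sub>i\<^sup>-\<^sup>1 h\<^sub>i\<^sub>+\<^sub>1 gel\<close> lie in the vertex groups, do
  not change under translation of the line, and change by the tuple action of the edge groups when the
  \<open>h\<^sub>i\<close> are chosen differently.  So the classes of tuples over a path of the quotient are exactly the
  \<open>\<Gamma>\<close>-orbits of the paths of the tree above it, and a line is coded by the classes of its windows of
  \<open>k + 1\<close> edges.  Consecutive windows overlap in \<open>k\<close> edges: compatible classes can be glued to a line, and
  by acylindricity the group element carrying one line to another on a window is determined on the
  overlap, hence is the same for all windows.  For geodesics as for codes, neighbourhoods are given by
  agreement on finite windows of indices, and a line whose code agrees with that of \<open>f\<close> on a finite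
  window has a translate that agrees with \<open>f\<close> there; this is continuity of the inverse.\<close>

section \<open>Paths of the tree and tuples over paths of the quotient\<close>

text \<open>The overlap of windows serves two purposes. To glue, comparison elements are taken
  between the lifts of consecutive windows, and any choice of them can be multiplied up along the
  integers. To tell lines apart, the comparison element must be unique, and this fixes the order:
  windows have \<open>k + 1\<close> edges so that neighbours share the \<open>k\<close> edges on
  which an element is determined. A path in the quotient may pass from an edge to its opposite
  although its lift does not backtrack. The last condition of the flow decides which case occurs:
  the double coset is trivial exactly when the lift backtracks. Since the alphabet may be infinite,
  compactness cannot turn a continuous bijection into a homeomorphism. The coding is therefore shown
  to be continuous, open and onto on the geodesics themselves, before passing to orbits; a quotient
  map whose fibres are the orbits then induces the homeomorphism. The tree property enters in the
  passage between real maps and edge sequences: edges are determined by their end points, and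
  reduced lines are injective.\<close>

locale lifted_action =
  fixes T :: "('v, 'e) serre_graph"
    and \<Gamma> :: "(('v \<Rightarrow> 'v) \<times> ('e \<Rightarrow> 'e)) set"
    and liftv :: "'v set \<Rightarrow> 'v"
    and lifte :: "'e set \<Rightarrow> 'e"
    and gel :: "'e set \<Rightarrow> ('v \<Rightarrow> 'v) \<times> ('e \<Rightarrow> 'e)"
  assumes serre: "serre_graph T"
    and subgroup: "subgroup \<Gamma> (graph_aut T)"
    and lift: "lift_choice T \<Gamma> liftv lifte gel"
begin

abbreviation G where "G \<equiv> aut_subgroup T \<Gamma>"
abbreviation X where "X \<equiv> quotient_graph_of_groups T \<Gamma> liftv lifte gel"
abbreviation mul (infixl "\<cdot>" 70) where "x \<cdot> y \<equiv> x \<otimes>\<^bsub>G\<^esub> y"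
abbreviation iv where "iv x \<equiv> inv\<^bsub>G\<^esub> x"
abbreviation orb where "orb e \<equiv> orbit G snd e"
abbreviation vorb where "vorb v \<equiv> orbit G fst v"

sublocale V: group_action G "verts T" fst
  by (rule aut_subgroup_actions[OF serre subgroup])

sublocale E: group_action G "edges T" snd
  by (rule aut_subgroup_actions[OF serre subgroup])

sublocale G: group G
  using V.group_hom by (rule group_hom.axioms)

section \<open>Equivariance and the chosen lifts\<close>

lemma carrier_G: "carrier G = \<Gamma>"
  by (simp add: aut_subgroup_def)

lemma edge_simps [simp]:
  assumes "e \<in> edges T"
  shows "origin T e \<in> verts T" "opposite T e \<in> edges T" "terminus T e \<in> verts T"
    "opposite T (opposite T e) = e" "origin T (opposite T e) = terminus T e"
    "terminus T (opposite T e) = origin T e" "opposite T e \<noteq> e"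
  using serre assms by (auto simp: serre_graph_def terminus_def)

lemma act_simps [simp]:
  assumes "g \<in> carrier G"
  shows "e \<in> edges T \<Longrightarrow> snd g e \<in> edges T"
    and "v \<in> verts T \<Longrightarrow> fst g v \<in> verts T"
    and "e \<in> edges T \<Longrightarrow> origin T (snd g e) = fst g (origin T e)"
    and "e \<in> edges T \<Longrightarrow> opposite T (snd g e) = snd g (opposite T e)"
    and "e \<in> edges T \<Longrightarrow> terminus T (snd g e) = fst g (terminus T e)"
proof -
  show 1: "e \<in> edges T \<Longrightarrow> snd g e \<in> edges T" "v \<in> verts T \<Longrightarrow> fst g v \<in> verts T"
    using E.element_image[OF assms] V.element_image[OF assms] by blast+
  show 2: "e \<in> edges T \<Longrightarrow> origin T (snd g e) = fst g (origin T e)"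
    "e \<in> edges T \<Longrightarrow> opposite T (snd g e) = snd g (opposite T e)" for e
    using aut_subgroup_equivariant[OF subgroup, of g] assms by (simp_all add: carrier_G)
  show "e \<in> edges T \<Longrightarrow> terminus T (snd g e) = fst g (terminus T e)"
    unfolding terminus_def by (simp only: 2 edge_simps(2))
qed

lemma act_mult [simp]:
  assumes "g \<in> carrier G" "h \<in> carrier G"
  shows "e \<in> edges T \<Longrightarrow> snd (g \<cdot> h) e = snd g (snd h e)"
    and "v \<in> verts T \<Longrightarrow> fst (g \<cdot> h) v = fst g (fst h v)"
  using assms by (simp_all add: E.composition_rule V.composition_rule)

lemma act_one [simp]: "e \<in> edges T \<Longrightarrow> snd \<one>\<^bsub>G\<^esub> e = e" "v \<in> verts T \<Longrightarrow> fst \<one>\<^bsub>G\<^esub> v = v"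
  by (metis E.id_eq_one restrict_apply') (metis V.id_eq_one restrict_apply')

lemma act_inv [simp]:
  assumes "g \<in> carrier G"
  shows "e \<in> edges T \<Longrightarrow> snd (iv g) (snd g e) = e" "e \<in> edges T \<Longrightarrow> snd g (snd (iv g) e) = e"
    "v \<in> verts T \<Longrightarrow> fst (iv g) (fst g v) = v" "v \<in> verts T \<Longrightarrow> fst g (fst (iv g) v) = v"
  using assms act_mult[of g "iv g"] act_mult[of "iv g" g] by (simp_all del: act_mult flip: act_mult)

lemma act_inj [simp]:
  assumes "g \<in> carrier G" "e \<in> edges T" "e' \<in> edges T"
  shows "snd g e = snd g e' \<longleftrightarrow> e = e'"
  using assms by (metis act_inv(1))

lemma mult_inv_cancel [simp]:
  assumes "x \<in> carrier G" "y \<in> carrier G"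
  shows "x \<cdot> (iv x \<cdot> y) = y" "iv x \<cdot> (x \<cdot> y) = y"
  using assms by (simp_all flip: G.m_assoc)

lemma orb_act [simp]:
  assumes "g \<in> carrier G" "e \<in> edges T"
  shows "orb (snd g e) = orb e"
proof -
  have sub: "orb (snd g e) \<subseteq> orb e" if "g \<in> carrier G" "e \<in> edges T" for g e
  proof
    fix x assume "x \<in> orb (snd g e)"
    then obtain h where "h \<in> carrier G" "x = snd h (snd g e)" unfolding orbit_def by blast
    then have "h \<cdot> g \<in> carrier G" "x = snd (h \<cdot> g) e" using that by simp_all
    then show "x \<in> orb e" unfolding orbit_def by blast
  qed
  \<comment> \<open>The reverse inclusion is the same statement for the inverse of \<open>g\<close>
    at the edge \<open>snd g e\<close>.\<close>
  show ?thesis using sub[of g e] sub[of "iv g" "snd g e"] assms by simp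
qed

lemma orb_eqD:
  assumes "orb e = orb e'" "e \<in> edges T"
  obtains g where "g \<in> carrier G" "snd g e' = e"
  using E.orbit_refl[OF assms(2)] unfolding assms(1) by (auto simp: orbit_def)

lemma X_simps [simp]:
  "verts X = orbits G (verts T) fst" "edges X = orbits G (edges T) snd"
  "origin X = (\<lambda>c. origin T ` c)" "opposite X = (\<lambda>c. opposite T ` c)"
  "vgroup X = (\<lambda>v. G\<lparr>carrier := stabilizer G fst (liftv v)\<rparr>)"
  "egroup X = (\<lambda>e. G\<lparr>carrier := stabilizer G snd (lifte e)\<rparr>)"
  "emb X = (\<lambda>e h. iv (gel e) \<cdot> h \<cdot> gel e)"
  by (simp_all add: quotient_graph_of_groups_def quotient_graph_def Let_def)

lemma orb_structure [simp]:
  assumes "e \<in> edges T"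
  shows "orb e \<in> orbits G (edges T) snd"
    "origin T ` orb e = vorb (origin T e)"
    "opposite T ` orb e = orb (opposite T e)"
    "terminus X (orb e) = vorb (terminus T e)"
proof -
  show "orb e \<in> orbits G (edges T) snd" using assms by (auto simp: orbits_def)
  have 1: "origin T ` orb e = vorb (origin T e)" "opposite T ` orb e = orb (opposite T e)"
    if "e \<in> edges T" for e using that origin_orbit[OF subgroup] by auto
  show "origin T ` orb e = vorb (origin T e)" "opposite T ` orb e = orb (opposite T e)"
    using assms 1 by blast+
  show "terminus X (orb e) = vorb (terminus T e)"
    using assms by (simp add: terminus_def[of X] 1)
qed

lemma lift_facts:
  assumes "e \<in> edges T"
  shows "lifte (orb e) \<in> edges T" "orb (lifte (orb e)) = orb e"
    "lifte (orb (opposite T e)) = opposite T (lifte (orb e))"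
    "gel (orb e) \<in> carrier G"
    "fst (gel (orb e)) (liftv (vorb (terminus T e))) = terminus T (lifte (orb e))"
proof -
  have "lifte (orb e) \<in> orb e"
    "opposite T (lifte (orb e)) = lifte (opposite X (orb e))"
    "gel (orb e) \<in> \<Gamma>"
    "fst (gel (orb e)) (liftv (terminus X (orb e))) = terminus T (lifte (orb e))"
    using lift orb_structure(1)[OF assms]
    by (auto simp: lift_choice_def quotient_graph_def terminus_def simp del: orb_structure(3))
  moreover from this(1) obtain g where "g \<in> carrier G" "lifte (orb e) = snd g e"
    unfolding orbit_def by blast
  ultimately show "lifte (orb e) \<in> edges T" "orb (lifte (orb e)) = orb e"
    "lifte (orb (opposite T e)) = opposite T (lifte (orb e))"
    "gel (orb e) \<in> carrier G"
    "fst (gel (orb e)) (liftv (vorb (terminus T e))) = terminus T (lifte (orb e))"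
    using assms by (simp_all add: carrier_G)
qed

text \<open>\<open>gel\<close> at an orbit serves its terminal vertex. The origin is reached through
  the opposite orbit, whose chosen lift is the opposite of the chosen lift.\<close>

lemma gel_opposite [simp]:
  assumes "e \<in> edges T"
  shows "gel (orb (opposite T e)) \<in> carrier G"
    "fst (gel (orb (opposite T e))) (liftv (vorb (origin T e))) = origin T (lifte (orb e))"
  using lift_facts[of "opposite T e"] lift_facts[of e] assms by auto

declare lift_facts [simp]

lemma liftv_mem [simp]: "v \<in> verts T \<Longrightarrow> liftv (vorb v) \<in> verts T"
proof -
  assume v: "v \<in> verts T"
  then have "vorb v \<in> orbits G (verts T) fst" by (auto simp: orbits_def)
  then have "liftv (vorb v) \<in> vorb v"
    using lift by (auto simp: lift_choice_def quotient_graph_def)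
  then obtain g where "g \<in> carrier G" "liftv (vorb v) = fst g v" unfolding orbit_def by blast
  then show ?thesis using v by simp
qed

section \<open>Frames, transitions and classes of paths\<close>

text \<open>For an edge \<open>e\<close> of \<open>T\<close> this is a left coset of the edge group
  at \<open>orb e\<close>; the freedom of choice inside it is the edge group factor of the tuple
  action.\<close>

definition frame :: "'e \<Rightarrow> (('v \<Rightarrow> 'v) \<times> ('e \<Rightarrow> 'e)) set" where
  "frame e = {h \<in> carrier G. snd h (lifte (orb e)) = e}"

lemma frameD:
  assumes "h \<in> frame e" shows "h \<in> carrier G" "snd h (lifte (orb e)) = e"
  using assms by (auto simp: frame_def)

lemma frame_nonempty:
  assumes "e \<in> edges T" obtains h where "h \<in> frame e"
  using orb_eqD[of e "lifte (orb e)"] assms by (metis (mono_tags, lifting) frame_def lift_facts(2) mem_Collect_eq)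

lemma frame_mult: "g \<in> carrier G \<Longrightarrow> e \<in> edges T \<Longrightarrow> h \<in> frame e \<Longrightarrow> g \<cdot> h \<in> frame (snd g e)"
  by (simp add: frame_def)

text \<open>If \<open>e\<close> ends where \<open>e'\<close> starts and \<open>h\<close>,
  \<open>h'\<close> are frames, then \<open>h \<cdot> gel (orb e)\<close> and
  \<open>h' \<cdot> gel (orb (opposite T e'))\<close> both carry the chosen lift of the common
  vertex to that vertex. The transition is the inverse of the former times the latter, so it fixes
  the lift.\<close>

definition transition where
  "transition e h e' h' = iv (gel (orb e)) \<cdot> iv h \<cdot> h' \<cdot> gel (orb (opposite T e'))"

lemma transition_stabilizer:
  assumes "e \<in> edges T" "e' \<in> edges T" "h \<in> frame e" "h' \<in> frame e'" "terminus T e = origin T e'"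
  shows "transition e h e' h' \<in> stabilizer G fst (liftv (vorb (origin T e')))"
proof -
  have "fst h' (origin T (lifte (orb e'))) = origin T e'"
    using assms frameD[of h' e'] act_simps(3)[of h' "lifte (orb e')"] by simp
  moreover have "fst h (terminus T (lifte (orb e))) = terminus T e"
    using assms frameD[of h e] act_simps(5)[of h "lifte (orb e)"] by simp
  then have "fst (iv h) (terminus T e) = terminus T (lifte (orb e))"
    using act_inv(3)[of h "terminus T (lifte (orb e))"] assms frameD[of h e] by simp
  moreover have "fst (iv (gel (orb e))) (terminus T (lifte (orb e))) = liftv (vorb (origin T e'))"
    using act_inv(3)[of "gel (orb e)" "liftv (vorb (origin T e'))"] lift_facts(5)[of e, unfolded assms(5)]
      assms by simp
  ultimately show ?thesis
    using assms frameD[of h e] frameD[of h' e'] by (simp add: transition_def stabilizer_def)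
qed

lemma transition_act:
  assumes "e \<in> edges T" "e' \<in> edges T" "h \<in> carrier G" "h' \<in> carrier G" "g \<in> carrier G"
  shows "transition (snd g e) (g \<cdot> h) (snd g e') (g \<cdot> h') = transition e h e' h'"
  using assms by (simp add: transition_def G.inv_mult_group G.m_assoc)

text \<open>The outer brackets are \<open>emb\<close> at \<open>orb e\<close> applied to
  \<open>a\<close> and \<open>emb\<close> at the orbit opposite to that of \<open>e'\<close> applied
  to the inverse of \<open>a'\<close>: a change of frames reproduces the formula of
  \<open>tuple_action\<close>.\<close>

lemma transition_twist:
  assumes "e \<in> edges T" "e' \<in> edges T" "h \<in> carrier G" "h' \<in> carrier G" "a \<in> carrier G" "a' \<in> carrier G"
  shows "transition e (h \<cdot> iv a) e' (h' \<cdot> iv a')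
    = (iv (gel (orb e)) \<cdot> a \<cdot> gel (orb e)) \<cdot> transition e h e' h' \<cdot>
      (iv (gel (orb (opposite T e'))) \<cdot> iv a' \<cdot> gel (orb (opposite T e')))"
  using assms by (simp add: transition_def G.inv_mult_group G.m_assoc)

text \<open>Once the \<open>gel\<close> factors cancel,
  \<open>iv h \<cdot> h' = iv j \<cdot> j'\<close>. For frames this says that the element carrying
  the first edge to its counterpart carries the second one as well.\<close>

lemma transition_eqD:
  assumes "e \<in> edges T" "e' \<in> edges T" "h \<in> carrier G" "h' \<in> carrier G" "j \<in> carrier G" "j' \<in> carrier G"
    and "orb e = orb d" "orb e' = orb d'" "d \<in> edges T" "d' \<in> edges T"
    and eq: "transition e h e' h' = transition d j d' j'"
  shows "j \<cdot> iv h = j' \<cdot> iv h'"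
proof -
  have "orb (opposite T e') = orb (opposite T d')"
    using assms by (metis orb_structure(3))
  then have "iv (gel (orb d)) \<cdot> (iv h \<cdot> h') \<cdot> gel (orb (opposite T d'))
      = iv (gel (orb d)) \<cdot> (iv j \<cdot> j') \<cdot> gel (orb (opposite T d'))"
    using eq assms by (simp add: transition_def G.m_assoc)
  then have "iv h \<cdot> h' = iv j \<cdot> j'"
    using assms by simp
  then have "j \<cdot> (iv h \<cdot> h') \<cdot> iv h' = j \<cdot> (iv j \<cdot> j') \<cdot> iv h'" by simp
  then show ?thesis using assms by (simp add: G.m_assoc)
qed

text \<open>Paths and frames are functions on all naturals, constrained only up to \<open>n\<close>,
  so that tails and windows are formed by reindexing.\<close>

definition frames where
  "frames n p = {h. \<forall>j\<le>n. h j \<in> frame (p j)}"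

definition transitions where
  "transitions n p h = map (\<lambda>j. transition (p j) (h j) (p (Suc j)) (h (Suc j))) [0..<n]"

text \<open>The class of the tuple of transitions does not depend on the frames, so it is taken to be
  the set of all transition tuples.\<close>

definition path_class where
  "path_class n p = transitions n p ` frames n p"

definition orb_path where
  "orb_path n p = map (\<lambda>j. orb (p j)) [0..<Suc n]"

lemma orb_path_nth [simp]: "j \<le> n \<Longrightarrow> orb_path n p ! j = orb (p j)"
  and length_orb_path [simp]: "length (orb_path n p) = Suc n"
  by (auto simp: orb_path_def simp del: upt_Suc)

definition tree_path :: "nat \<Rightarrow> (nat \<Rightarrow> 'e) \<Rightarrow> bool" where
  "tree_path n p \<longleftrightarrow> (\<forall>j\<le>n. p j \<in> edges T) \<and> (\<forall>j<n. terminus T (p j) = origin T (p (Suc j)))"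

lemma frames_nonempty:
  assumes "\<forall>j\<le>n. p j \<in> edges T" obtains h where "h \<in> frames n p"
proof -
  have "frame (p j) \<noteq> {}" if "j \<le> n" for j using assms that frame_nonempty by blast
  then have "(\<lambda>j. SOME h. h \<in> frame (p j)) \<in> frames n p"
    by (auto simp: frames_def some_in_eq)
  then show ?thesis by (rule that)
qed

lemma frames_carrier: "h \<in> frames n p \<Longrightarrow> j \<le> n \<Longrightarrow> h j \<in> carrier G"
  by (simp add: frames_def frame_def)

text \<open>By \<open>transition_twist\<close>, acting with an edge tuple amounts to multiplying
  each frame on the right by the inverse of the corresponding entry.\<close>

lemma tuple_action_transitions:
  assumes p: "\<forall>j\<le>n. p j \<in> edges T" and h: "h \<in> frames n p"
    and as: "as \<in> edge_tuples X (orb_path n p)"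
  shows "tuple_action X (orb_path n p) as (transitions n p h)
     = transitions n p (\<lambda>j. h j \<cdot> iv (as ! j))"
proof (rule nth_equalityI)
  show "length (tuple_action X (orb_path n p) as (transitions n p h))
      = length (transitions n p (\<lambda>j. h j \<cdot> iv (as ! j)))"
    by (simp add: tuple_action_def transitions_def)
  fix j assume "j < length (tuple_action X (orb_path n p) as (transitions n p h))"
  then have j: "j < n" by (simp add: tuple_action_def transitions_def)
  have a: "as ! i \<in> stabilizer G snd (lifte (orb (p i)))" if "i \<le> n" for i
  proof -
    have "length as = Suc n" "\<And>j. j < length as \<Longrightarrow> as ! j \<in> stabilizer G snd (lifte (orb_path n p ! j))"
      using as by (auto simp: edge_tuples_def)
    from this(1) this(2)[of i] show ?thesis using that by simp
  qed
  have ac: "as ! i \<in> carrier G" if "i \<le> n" for i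
    using a[OF that] by (simp add: stabilizer_def)
  \<comment> \<open>\<open>tuple_action\<close> inverts in the edge group,
    \<open>transition_twist\<close> in \<open>G\<close>.\<close>
  have "inv\<^bsub>egroup X (orb (p (Suc j)))\<^esub> (as ! Suc j) = iv (as ! Suc j)"
    using j p a[of "Suc j"] by (simp add: G.m_inv_consistent E.stabilizer_subgroup)
  moreover have "h i \<in> carrier G" if "i \<le> n" for i
    using h that by (rule frames_carrier)
  ultimately show "tuple_action X (orb_path n p) as (transitions n p h) ! j
      = transitions n p (\<lambda>j. h j \<cdot> iv (as ! j)) ! j"
    using j p ac by (simp add: tuple_action_def transitions_def transition_twist)
qed

text \<open>Each set of frames is a coset of an edge group, so the edge tuples act transitively on
  the choices of frames and the orbit of one transition tuple contains all of them.\<close>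

lemma tuple_class_transitions:
  assumes p: "\<forall>j\<le>n. p j \<in> edges T" and h: "h \<in> frames n p"
  shows "tuple_class X (orb_path n p) (transitions n p h) = path_class n p"
proof (intro equalityI subsetI)
  fix gs assume "gs \<in> tuple_class X (orb_path n p) (transitions n p h)"
  then obtain as where as: "as \<in> edge_tuples X (orb_path n p)"
    "gs = tuple_action X (orb_path n p) as (transitions n p h)" by (auto simp: tuple_class_def)
  have "(\<lambda>j. h j \<cdot> iv (as ! j)) \<in> frames n p"
    unfolding frames_def
  proof (intro CollectI allI impI)
    fix j assume j: "j \<le> n"
    then have "as ! j \<in> stabilizer G snd (lifte (orb (p j)))" "p j \<in> edges T" "h j \<in> frame (p j)"
      using as p h by (auto simp: edge_tuples_def frames_def)
    then show "h j \<cdot> iv (as ! j) \<in> frame (p j)"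
      using act_inv(1)[of "as ! j" "lifte (orb (p j))"] by (auto simp: frame_def stabilizer_def)
  qed
  then show "gs \<in> path_class n p"
    using as tuple_action_transitions[OF p h] by (auto simp: path_class_def)
next
  fix gs assume "gs \<in> path_class n p"
  then obtain h' where h': "h' \<in> frames n p" "gs = transitions n p h'" by (auto simp: path_class_def)
  \<comment> \<open>Solves \<open>h j \<cdot> iv (as ! j) = h' j\<close>; both frames move the same
    lift to \<open>p j\<close>, so the entries lie in the edge groups.\<close>
  define as where "as = map (\<lambda>j. iv (h' j) \<cdot> h j) [0..<Suc n]"
  have c: "h j \<in> carrier G" "h' j \<in> carrier G" "snd (h j) (lifte (orb (p j))) = p j"
    "snd (h' j) (lifte (orb (p j))) = p j" "p j \<in> edges T" if "j \<le> n" for j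
    using h h' p that by (auto simp: frames_def frame_def)
  have nth: "as ! j = iv (h' j) \<cdot> h j" if "j \<le> n" for j
    using that by (simp add: as_def del: upt_Suc)
  have "iv (h' j) \<cdot> h j \<in> stabilizer G snd (lifte (orb (p j)))" if "j \<le> n" for j
    using c[OF that] act_inv(1)[of "h' j" "lifte (orb (p j))"] by (simp add: stabilizer_def)
  then have as: "as \<in> edge_tuples X (orb_path n p)"
    by (simp add: edge_tuples_def nth less_Suc_eq_le as_def del: upt_Suc)
  have "h j \<cdot> iv (as ! j) = h' j" if "j \<le> n" for j
    using c[OF that] by (simp add: nth that G.inv_mult_group)
  then have "transitions n p (\<lambda>j. h j \<cdot> iv (as ! j)) = gs"
    by (simp add: h'(2) transitions_def)
  then have "gs = tuple_action X (orb_path n p) as (transitions n p h)"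
    using tuple_action_transitions[OF p h as] by simp
  then show "gs \<in> tuple_class X (orb_path n p) (transitions n p h)"
    unfolding tuple_class_def using as by blast
qed

lemma transitions_vertex_tuples:
  assumes p: "tree_path n p" and h: "h \<in> frames n p"
  shows "transitions n p h \<in> vertex_tuples X (orb_path n p)"
  using p h transition_stabilizer
  by (auto simp: vertex_tuples_def transitions_def tree_path_def frames_def)

lemma orb_path_edge_path:
  assumes p: "tree_path n p"
  shows "orb_path n p \<in> k_paths n X"
  using p by (auto simp: k_paths_def edge_path_def tree_path_def successively_conv_nth
      set_conv_nth less_Suc_eq_le orbits_def)

lemma path_class_in_tuple_classes:
  assumes p: "tree_path n p"
  shows "path_class n p \<in> tuple_classes X (orb_path n p)"
proof -
  have p': "\<forall>j\<le>n. p j \<in> edges T" using p by (simp add: tree_path_def)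
  obtain h where h: "h \<in> frames n p" using frames_nonempty[OF p'] .
  show ?thesis
    unfolding tuple_classes_def tuple_class_transitions[OF p' h, symmetric]
    using transitions_vertex_tuples[OF p h] by (rule imageI)
qed

text \<open>Multiplying all frames by \<open>g\<close> on the left keeps every transition, which
  gives one inclusion; the inverse of \<open>g\<close> gives the other.\<close>

lemma path_class_act:
  assumes p: "\<forall>j\<le>n. p j \<in> edges T" and g: "g \<in> carrier G"
  shows "path_class n (\<lambda>j. snd g (p j)) = path_class n p"
proof -
  have sub: "path_class n p \<subseteq> path_class n (\<lambda>j. snd g (p j))"
    if p: "\<forall>j\<le>n. p j \<in> edges T" and g: "g \<in> carrier G" for p g
  proof
    fix gs assume "gs \<in> path_class n p"
    then obtain h where h: "h \<in> frames n p" "gs = transitions n p h" by (auto simp: path_class_def)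
    have "(\<lambda>j. g \<cdot> h j) \<in> frames n (\<lambda>j. snd g (p j))"
      using h p g by (auto simp: frames_def frame_mult)
    moreover have "h j \<in> carrier G" if "j \<le> n" for j using h(1) that by (rule frames_carrier)
    then have "transitions n (\<lambda>j. snd g (p j)) (\<lambda>j. g \<cdot> h j) = gs"
      using h p g by (simp add: transitions_def transition_act)
    ultimately show "gs \<in> path_class n (\<lambda>j. snd g (p j))" by (auto simp: path_class_def)
  qed
  have "frames n (\<lambda>j. snd (iv g) (snd g (p j))) = frames n p"
    using p g by (simp add: frames_def)
  moreover have "transitions n (\<lambda>j. snd (iv g) (snd g (p j))) = transitions n p"
    using p g by (auto simp: transitions_def transition_def)
  ultimately have "path_class n (\<lambda>j. snd (iv g) (snd g (p j))) = path_class n p"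
    by (simp add: path_class_def)
  then show ?thesis
    using sub[OF p g] sub[of "\<lambda>j. snd g (p j)" "iv g"] p g by auto
qed

lemma path_class_cong:
  assumes "\<And>j. j \<le> n \<Longrightarrow> p j = q j"
  shows "path_class n p = path_class n q"
proof -
  have "frames n p = frames n q" using assms by (simp add: frames_def)
  moreover have "transitions n p = transitions n q" by (rule ext) (simp add: transitions_def assms)
  ultimately show ?thesis by (simp add: path_class_def)
qed

text \<open>Equal classes allow frames \<open>h\<close> and \<open>h'\<close> of the two paths with
  equal transitions. Then \<open>h' j \<cdot> iv (h j)\<close> is independent of \<open>j\<close> by
  \<open>transition_eqD\<close>, and this element carries \<open>p j\<close> through the common lift
  to \<open>q j\<close>.\<close>

lemma same_class_imp_translate:
  assumes p: "\<forall>j\<le>n. p j \<in> edges T" and q: "\<forall>j\<le>n. q j \<in> edges T"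
    and orb: "orb_path n p = orb_path n q" and cls: "path_class n p = path_class n q"
  obtains g where "g \<in> carrier G" "\<And>j. j \<le> n \<Longrightarrow> snd g (p j) = q j"
proof -
  obtain h where h: "h \<in> frames n p" using frames_nonempty[OF p] .
  then have "transitions n p h \<in> path_class n p" unfolding path_class_def by (rule imageI)
  then have "transitions n p h \<in> path_class n q" by (simp only: cls)
  then obtain h' where h': "h' \<in> frames n q" and eq: "transitions n p h = transitions n q h'"
    by (auto simp: path_class_def)
  have o: "orb (p j) = orb (q j)" if "j \<le> n" for j
    using orb that orb_path_nth by metis
  have c: "h j \<in> carrier G" "h' j \<in> carrier G" "snd (h j) (lifte (orb (p j))) = p j"
    "snd (h' j) (lifte (orb (p j))) = q j" if "j \<le> n" for j
    using h h' o that by (auto simp: frames_def frame_def)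
  have const: "h' j \<cdot> iv (h j) = h' 0 \<cdot> iv (h 0)" if "j \<le> n" for j
    using that
  proof (induction j)
    case (Suc j)
    have "transition (p j) (h j) (p (Suc j)) (h (Suc j)) = transition (q j) (h' j) (q (Suc j)) (h' (Suc j))"
      using eq Suc.prems by (simp add: transitions_def)
    then have "h' j \<cdot> iv (h j) = h' (Suc j) \<cdot> iv (h (Suc j))"
      using Suc.prems by (intro transition_eqD) (auto simp: p q c o)
    then show ?case using Suc by simp
  qed simp
  show ?thesis
  proof
    show "h' 0 \<cdot> iv (h 0) \<in> carrier G" using c by simp
    fix j assume j: "j \<le> n"
    have "snd (iv (h j)) (p j) = lifte (orb (p j))"
      using act_inv(1)[of "h j" "lifte (orb (p j))"] c[OF j] p j by simp
    then show "snd (h' 0 \<cdot> iv (h 0)) (p j) = q j"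
      using j c[OF j] p q by (simp flip: const[OF j])
  qed
qed

section \<open>Projections of classes and the backtracking condition\<close>

text \<open>Frames at different indices are chosen independently: dropping the first entry forgets
  one frame, and any frames of the tail extend since \<open>p 0\<close> has a frame. The same reason
  gives the other two projections.\<close>

lemma tl_path_class:
  assumes p: "p 0 \<in> edges T"
  shows "tl ` path_class (Suc n) p = path_class n (\<lambda>j. p (Suc j))"
proof (intro equalityI subsetI)
  have tl: "tl (transitions (Suc n) p h) = transitions n (\<lambda>j. p (Suc j)) (\<lambda>j. h (Suc j))" for h
    by (simp add: transitions_def map_tl[symmetric] del: upt_Suc)
       (simp add: map_Suc_upt[symmetric] comp_def del: upt_Suc map_Suc_upt)
  { fix gs assume "gs \<in> tl ` path_class (Suc n) p"
    then obtain h where "h \<in> frames (Suc n) p" "gs = tl (transitions (Suc n) p h)"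
      by (auto simp: path_class_def)
    then show "gs \<in> path_class n (\<lambda>j. p (Suc j))"
      unfolding path_class_def tl by (auto simp: frames_def) }
  fix gs assume "gs \<in> path_class n (\<lambda>j. p (Suc j))"
  then obtain h where h: "h \<in> frames n (\<lambda>j. p (Suc j))" "gs = transitions n (\<lambda>j. p (Suc j)) h"
    by (auto simp: path_class_def)
  obtain h0 where h0: "h0 \<in> frame (p 0)" using frame_nonempty[OF p] .
  have "case_nat h0 h \<in> frames (Suc n) p"
    using h h0 by (auto simp: frames_def split: nat.split)
  moreover have "gs = tl (transitions (Suc n) p (case_nat h0 h))" by (simp add: tl h)
  ultimately show "gs \<in> tl ` path_class (Suc n) p" by (auto simp: path_class_def)
qed

lemma butlast_path_class:
  assumes p: "p (Suc n) \<in> edges T"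
  shows "butlast ` path_class (Suc n) p = path_class n p"
proof (intro equalityI subsetI)
  have bl: "butlast (transitions (Suc n) p h) = transitions n p h" for h
    by (simp add: transitions_def)
  { fix gs assume "gs \<in> butlast ` path_class (Suc n) p"
    then show "gs \<in> path_class n p"
      by (auto simp: path_class_def bl frames_def) }
  fix gs assume "gs \<in> path_class n p"
  then obtain h where h: "h \<in> frames n p" "gs = transitions n p h"
    by (auto simp: path_class_def)
  obtain h0 where h0: "h0 \<in> frame (p (Suc n))" using frame_nonempty[OF p] .
  have "h(Suc n := h0) \<in> frames (Suc n) p"
    using h h0 by (auto simp: frames_def le_Suc_eq)
  moreover have "gs = butlast (transitions (Suc n) p (h(Suc n := h0)))"
    by (simp add: bl h transitions_def)
  ultimately show "gs \<in> butlast ` path_class (Suc n) p" by (auto simp: path_class_def)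
qed

lemma last_path_class:
  assumes p: "\<forall>j\<le>Suc n. p j \<in> edges T"
  shows "last ` path_class (Suc n) p =
    {transition (p n) h (p (Suc n)) h' | h h'. h \<in> frame (p n) \<and> h' \<in> frame (p (Suc n))}"
proof (intro equalityI subsetI)
  have la: "last (transitions (Suc n) p h) = transition (p n) (h n) (p (Suc n)) (h (Suc n))" for h
    by (simp add: transitions_def)
  { fix x assume "x \<in> last ` path_class (Suc n) p"
    then obtain h where "h \<in> frames (Suc n) p" "x = transition (p n) (h n) (p (Suc n)) (h (Suc n))"
      unfolding path_class_def using la by auto
    moreover from this(1) have "h n \<in> frame (p n)" "h (Suc n) \<in> frame (p (Suc n))"
      by (auto simp: frames_def)
    ultimately show "x \<in> {transition (p n) h (p (Suc n)) h' | h h'. h \<in> frame (p n) \<and> h' \<in> frame (p (Suc n))}"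
      by blast }
  fix x assume "x \<in> {transition (p n) h (p (Suc n)) h' | h h'. h \<in> frame (p n) \<and> h' \<in> frame (p (Suc n))}"
  then obtain h h' where h: "h \<in> frame (p n)" "h' \<in> frame (p (Suc n))"
    "x = transition (p n) h (p (Suc n)) h'" by blast
  obtain f where f: "f \<in> frames (Suc n) p" using frames_nonempty[OF p] .
  have "f(n := h, Suc n := h') \<in> frames (Suc n) p" using f h by (auto simp: frames_def)
  moreover have "x = last (transitions (Suc n) p (f(n := h, Suc n := h')))" by (simp add: la h)
  ultimately show "x \<in> last ` path_class (Suc n) p" by (auto simp: path_class_def)
qed

text \<open>If the orbits are opposite, their lifts are opposite edges with a common stabilizer. Up
  to conjugation by one \<open>gel\<close>, the right side is this stabilizer and the left side
  consists of the products \<open>iv h \<cdot> h'\<close>; such a product fixes the lift only if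
  \<open>h\<close> and \<open>h'\<close> carry the two opposite lifts to opposite edges.\<close>

lemma last_trivial_iff_backtrack:
  assumes p: "\<forall>j\<le>Suc n. p j \<in> edges T"
    and opp: "orb (p (Suc n)) = opposite X (orb (p n))"
  shows "last ` path_class (Suc n) p
      = emb X (opposite X (orb (p (Suc n)))) ` carrier (egroup X (orb (p (Suc n))))
    \<longleftrightarrow> p (Suc n) = opposite T (p n)"
    (is "?L = ?R \<longleftrightarrow> _")
proof -
  define d e where "d = p n" and "e = p (Suc n)"
  have de: "d \<in> edges T" "e \<in> edges T" and oe: "orb e = orb (opposite T d)" 
    using p opp by (auto simp: d_def e_def)
  have oe': "orb (opposite T e) = orb d"
    using oe de by (metis edge_simps(2,4) orb_structure(3))
  have le: "lifte (orb e) = opposite T (lifte (orb d))"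
    using oe de by simp
  have L: "?L = {iv (gel (orb d)) \<cdot> (iv h \<cdot> h') \<cdot> gel (orb d) | h h'. h \<in> frame d \<and> h' \<in> frame e}"
  proof -
    have tr: "transition d h e h' = iv (gel (orb d)) \<cdot> (iv h \<cdot> h') \<cdot> gel (orb d)"
      if "h \<in> frame d" "h' \<in> frame e" for h h'
      using de oe' that by (simp add: transition_def frameD G.m_assoc)
    show ?thesis
      unfolding last_path_class[OF p] d_def[symmetric] e_def[symmetric]
      by (intro Collect_cong ex_cong1) (metis tr)
  qed
  have R: "?R = (\<lambda>x. iv (gel (orb d)) \<cdot> x \<cdot> gel (orb d)) ` stabilizer G snd (lifte (orb e))"
    using de oe' by (simp flip: d_def e_def)
  have stab: "x \<in> stabilizer G snd (lifte (orb e)) \<longleftrightarrow> x \<in> carrier G \<and> snd x (lifte (orb d)) = lifte (orb d)" for x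
  proof -
    have "snd x (opposite T (lifte (orb d))) = opposite T (lifte (orb d)) \<longleftrightarrow> snd x (lifte (orb d)) = lifte (orb d)"
      if "x \<in> carrier G"
      using that de by (metis act_simps(1,4) edge_simps(4) lift_facts(1))
    then show ?thesis by (auto simp: stabilizer_def le)
  qed
  have key: "e = opposite T d" if h: "h \<in> frame d" "h' \<in> frame e" and st: "iv h \<cdot> h' \<in> stabilizer G snd (lifte (orb e))" for h h'
  proof -
    have c: "h \<in> carrier G" "h' \<in> carrier G" "snd h (lifte (orb d)) = d" "snd h' (lifte (orb e)) = e"
      using h frameD by auto
    have "snd (iv h \<cdot> h') (lifte (orb e)) = lifte (orb e)" using st by (simp add: stabilizer_def)
    then have "snd h (snd (iv h) e) = snd h (lifte (orb e))" using c de by simp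
    then have "e = snd h (opposite T (lifte (orb d)))" using c de le by simp
    then show ?thesis using c de act_simps(4)[of h "lifte (orb d)"] by simp
  qed
  obtain h0 where h0: "h0 \<in> frame d" using frame_nonempty de by blast
  obtain h0' where h0': "h0' \<in> frame e" using frame_nonempty de by blast
  show ?thesis
  proof
    assume "?L = ?R"
    \<comment> \<open>A single element of the left side in the stabilizer is enough to force
      backtracking.\<close>
    moreover have "iv (gel (orb d)) \<cdot> (iv h0 \<cdot> h0') \<cdot> gel (orb d) \<in> ?L" using h0 h0' unfolding L by blast
    ultimately obtain x where x: "x \<in> stabilizer G snd (lifte (orb e))"
      "iv (gel (orb d)) \<cdot> (iv h0 \<cdot> h0') \<cdot> gel (orb d) = iv (gel (orb d)) \<cdot> x \<cdot> gel (orb d)"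
      unfolding R by blast
    then have "iv h0 \<cdot> h0' = x" using h0 h0' de by (simp add: stab frameD)
    then show "p (Suc n) = opposite T (p n)" using key[OF h0 h0'] x(1) by (simp add: d_def e_def)
  next
    assume "p (Suc n) = opposite T (p n)"
    then have e: "e = opposite T d" by (simp add: d_def e_def)
    \<comment> \<open>Both frames now range over one coset of the stabilizer, so the products
      \<open>iv h \<cdot> h'\<close> fill exactly the stabilizer.\<close>
    have fr: "frame e = frame d"
    proof -
      have "snd h (opposite T (lifte (orb d))) = opposite T d \<longleftrightarrow> snd h (lifte (orb d)) = d"
        if "h \<in> carrier G" for h
        using that de by (metis act_simps(1,4) edge_simps(4) lift_facts(1))
      then show ?thesis using de by (auto simp: frame_def e)
    qed
    have "{iv h \<cdot> h' | h h'. h \<in> frame d \<and> h' \<in> frame e} = stabilizer G snd (lifte (orb e))"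
    proof (intro equalityI subsetI)
      fix x assume "x \<in> {iv h \<cdot> h' | h h'. h \<in> frame d \<and> h' \<in> frame e}"
      then obtain h h' where "h \<in> frame d" "h' \<in> frame d" "x = iv h \<cdot> h'" using fr by auto
      then show "x \<in> stabilizer G snd (lifte (orb e))"
        using de act_inv(1)[of h "lifte (orb d)"] by (simp add: stab frame_def)
    next
      fix x assume x: "x \<in> stabilizer G snd (lifte (orb e))"
      then have "h0 \<cdot> x \<in> frame e" unfolding fr using h0 de by (simp add: stab frame_def)
      moreover have "x = iv h0 \<cdot> (h0 \<cdot> x)" using x h0 by (simp add: stab frameD)
      ultimately show "x \<in> {iv h \<cdot> h' | h h'. h \<in> frame d \<and> h' \<in> frame e}" using h0 by blast
    qed
    then show "?L = ?R" unfolding L R by (simp only: flip: \<open>_ = stabilizer _ _ _\<close>) blast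
  qed
qed

text \<open>The transition formula can be solved for the next frame, so a tuple of vertex group
  elements develops step by step into a path of \<open>T\<close>, starting at the chosen lift of the
  first edge.\<close>

lemma tuple_class_lifts:
  assumes es: "es \<in> k_paths n X" and C: "C \<in> tuple_classes X es"
  obtains p where "tree_path n p" "orb_path n p = es" "path_class n p = C"
proof -
  obtain gs where gs: "gs \<in> vertex_tuples X es" "C = tuple_class X es gs"
    using C by (auto simp: tuple_classes_def)
  have len: "length es = Suc n" "length gs = n" using es gs by (auto simp: k_paths_def vertex_tuples_def)
  have "\<exists>r. r \<in> edges T \<and> es ! j = orb r" if "j \<le> n" for j
  proof -
    have "es ! j \<in> set es" using that len by simp
    then have "es ! j \<in> orbits G (edges T) snd" using es by (auto simp: k_paths_def edge_path_def)
    then show ?thesis by (auto simp: orbits_def)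
  qed
  then obtain r where r: "\<And>j. j \<le> n \<Longrightarrow> r j \<in> edges T" "\<And>j. j \<le> n \<Longrightarrow> es ! j = orb (r j)" by metis
  \<comment> \<open>The value that \<open>iv (h j) \<cdot> h (Suc j)\<close> must have for the
    transition to be \<open>gs ! j\<close>. The edges \<open>r j\<close> merely represent the orbits
    \<open>es ! j\<close>; the path itself is \<open>p\<close>.\<close>
  define g where "g = (\<lambda>j. gel (orb (r j)) \<cdot> gs ! j \<cdot> iv (gel (orb (opposite T (r (Suc j))))))"
  define h where "h = rec_nat \<one>\<^bsub>G\<^esub> (\<lambda>j x. x \<cdot> g j)"
  define p where "p = (\<lambda>j. snd (h j) (lifte (orb (r j))))"
  have h_simps: "h 0 = \<one>\<^bsub>G\<^esub>" "h (Suc j) = h j \<cdot> g j" for j by (simp_all add: h_def)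
  have gst: "gs ! j \<in> stabilizer G fst (liftv (vorb (origin T (r (Suc j)))))" if "j < n" for j
    using gs that r len by (simp add: vertex_tuples_def)
  have gsc: "gs ! j \<in> carrier G" if "j < n" for j using gst[OF that] by (simp add: stabilizer_def)
  have gc: "g j \<in> carrier G" if "j < n" for j using gsc[OF that] that r by (simp add: g_def)
  have hc: "h j \<in> carrier G" if "j \<le> n" for j using that by (induction j) (auto simp: h_simps gc)
  have pe: "p j \<in> edges T" "orb (p j) = orb (r j)" if "j \<le> n" for j
    using that hc r by (simp_all add: p_def)
  have fr: "h j \<in> frame (p j)" if "j \<le> n" for j
    using that hc pe by (simp add: frame_def) (simp add: p_def)
  have vt: "vorb (terminus T (r j)) = vorb (origin T (r (Suc j)))" if "j < n" for j
  proof -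
    have "terminus X (es ! j) = origin X (es ! Suc j)"
      using es that len by (auto simp: k_paths_def edge_path_def successively_conv_nth)
    then show ?thesis using that r by simp
  qed
  \<comment> \<open>As \<open>gs ! j\<close> fixes the chosen lift of the vertex, \<open>g j\<close>
    moves the origin of the next lifted edge to the end of the current one.\<close>
  have path: "terminus T (p j) = origin T (p (Suc j))" if j: "j < n" for j
  proof -
    have "fst (iv (gel (orb (opposite T (r (Suc j)))))) (origin T (lifte (orb (r (Suc j)))))
        = liftv (vorb (origin T (r (Suc j))))"
      using act_inv(3)[of "gel (orb (opposite T (r (Suc j))))" "liftv (vorb (origin T (r (Suc j))))"] r j
      by simp
    then have "fst (g j) (origin T (lifte (orb (r (Suc j))))) = terminus T (lifte (orb (r j)))"
      using gst[OF j] r j vt[OF j, symmetric] by (simp add: g_def stabilizer_def)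
    then show ?thesis using j r hc gc by (simp add: p_def h_simps)
  qed
  have tp: "tree_path n p" using pe path by (simp add: tree_path_def)
  have op: "orb_path n p = es"
    by (rule nth_equalityI) (simp_all add: len pe r less_Suc_eq_le)
  have "transition (p j) (h j) (p (Suc j)) (h (Suc j)) = gs ! j" if j: "j < n" for j
  proof -
    have "orb (opposite T (p (Suc j))) = orb (opposite T (r (Suc j)))"
      using pe[of "Suc j"] r[of "Suc j"] j by (metis Suc_leI orb_structure(3))
    then show ?thesis
      using j pe[of j] hc[of j] gsc[OF j] r by (simp add: transition_def h_simps g_def G.m_assoc)
  qed
  then have "transitions n p h = gs"
    by (intro nth_equalityI) (simp_all add: transitions_def len)
  then have "path_class n p = C"
    using tuple_class_transitions[of n p h] fr pe gs(2) op by (simp add: frames_def)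
  then show ?thesis using that tp op by blast
qed

end

section \<open>Coding of reduced lines\<close>

lemma in_topspace_full_shift: "s \<in> topspace (full_shift A) \<longleftrightarrow> (\<forall>i. s i \<in> A)"
  by (auto simp: full_shift_def PiE_UNIV_domain)

definition reduced_lines :: "('v, 'e, 'm) serre_graph_scheme \<Rightarrow> (int \<Rightarrow> 'e) set" where
  "reduced_lines X = {f. \<forall>i. f i \<in> edges X \<and> terminus X (f i) = origin X (f (i + 1))
     \<and> f (i + 1) \<noteq> opposite X (f i)}"

lemma reduced_linesD:
  assumes "f \<in> reduced_lines X"
  shows "f i \<in> edges X" "terminus X (f i) = origin X (f (i + 1))" "f (i + 1) \<noteq> opposite X (f i)"
  using assms by (auto simp: reduced_lines_def)

text \<open>Partial products in both directions from index 0. They turn comparison elements between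
  neighbouring windows into one coherent family of corrections.\<close>

lemma (in group) int_product_exists:
  assumes "\<And>i::int. g i \<in> carrier G"
  obtains d where "\<And>i. d i \<in> carrier G" "\<And>i. d (i + 1) = d i \<otimes> g i"
proof -
  define u where "u = rec_nat \<one> (\<lambda>m x. x \<otimes> g (int m))"
  \<comment> \<open>\<open>w m\<close> is the value at \<open>- m\<close>; the recursion at
    \<open>- m - 1\<close>, solved backwards, gives the index of the inverted factor.\<close>
  define w where "w = rec_nat \<one> (\<lambda>m x. x \<otimes> inv (g (- int m - 1)))"
  define d where "d = (\<lambda>i. if i \<ge> 0 then u (nat i) else w (nat (- i)))"
  have u: "u 0 = \<one>" "u (Suc m) = u m \<otimes> g (int m)" for m by (simp_all add: u_def)
  have w: "w 0 = \<one>" "w (Suc m) = w m \<otimes> inv (g (- int m - 1))" for m by (simp_all add: w_def)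
  have uc: "u m \<in> carrier G" for m by (induction m) (simp_all add: u assms)
  have wc: "w m \<in> carrier G" for m by (induction m) (simp_all add: w assms)
  have "d (i + 1) = d i \<otimes> g i" for i
  proof (cases "i \<ge> 0")
    case True
    then have "nat (i + 1) = Suc (nat i)" by simp
    then show ?thesis using True by (simp add: d_def u)
  next
    case False
    define m where "m = nat (- i - 1)"
    have m: "nat (- i) = Suc m" "- int m - 1 = i" using False by (simp_all add: m_def)
    have "d (i + 1) = w m"
      using False by (cases "i = -1") (auto simp: d_def m_def u w)
    moreover have "d i = w m \<otimes> inv (g i)"
      using False unfolding d_def m by (simp add: w m)
    ultimately show ?thesis using wc assms by (simp add: m_assoc)
  qed
  moreover have "d i \<in> carrier G" for i by (simp add: d_def uc wc)
  ultimately show ?thesis using that by blast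
qed

context lifted_action
begin

definition window :: "nat \<Rightarrow> (int \<Rightarrow> 'e) \<Rightarrow> int \<Rightarrow> nat \<Rightarrow> 'e" where
  "window k f i = (\<lambda>j. f (i - int k + int j))"

definition code :: "nat \<Rightarrow> (int \<Rightarrow> 'e) \<Rightarrow> int
    \<Rightarrow> ('e set list \<times> (('v \<Rightarrow> 'v) \<times> ('e \<Rightarrow> 'e)) list set) \<times> 'e set" where
  "code k f i = ((orb_path k (window k f i), path_class k (window k f i)), orb (f i))"

lemma window_end: "window k f i k = f i"
  by (simp add: window_def)

lemma window_Suc: "window (Suc n) f (i + 1) j = window (Suc n) f i (Suc j)"
  by (simp add: window_def algebra_simps)

lemma edge_window_code: "edge_window k (code k f) i = orb_path k (window k f i)"
  by (simp add: edge_window_def code_def orb_path_def window_def)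

lemma window_tree_path: "f \<in> reduced_lines T \<Longrightarrow> tree_path k (window k f i)"
  using reduced_linesD[of f T] by (simp add: tree_path_def window_def add.assoc add.commute[of 1])

lemma code_act:
  assumes "f \<in> reduced_lines T" "g \<in> carrier G"
  shows "code k (\<lambda>i. snd g (f i)) = code k f"
proof
  fix i
  have "window k (\<lambda>i. snd g (f i)) i = (\<lambda>j. snd g (window k f i j))"
    by (simp add: window_def)
  moreover have "window k f i j \<in> edges T" for j
    using assms by (simp add: window_def reduced_linesD)
  ultimately show "code k (\<lambda>i. snd g (f i)) i = code k f i"
    using assms by (simp add: code_def path_class_act orb_path_def reduced_linesD)
qed

lemma reduced_lines_act:
  assumes "f \<in> reduced_lines T" "g \<in> carrier G"
  shows "(\<lambda>i. snd g (f i)) \<in> reduced_lines T"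
  using assms reduced_linesD[OF assms(1)] by (simp add: reduced_lines_def)

lemma code_shift: "code k (\<lambda>i. f (i + 1)) = left_shift (code k f)"
proof -
  have "window k (\<lambda>i. f (i + 1)) i = window k f (i + 1)" for i
    by (rule ext) (simp add: window_def algebra_simps)
  then show ?thesis by (intro ext) (simp add: code_def left_shift_def)
qed

text \<open>Both projections of neighbouring letters are the class of the shared part of their
  windows, and a reduced line has no trivial double coset by
  \<open>last_trivial_iff_backtrack\<close>.\<close>

lemma code_in_flow:
  assumes k: "k \<ge> 1" and f: "f \<in> reduced_lines T"
  shows "code k f \<in> geodesic_flow k X"
proof -
  obtain n where n: "k = Suc n" using k by (cases k) auto
  have w: "window k f i j \<in> edges T" for i j using f by (simp add: window_def reduced_linesD)
  have 1: "code k f i \<in> flow_alphabet k X" for i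
    using f orb_path_edge_path[OF window_tree_path] path_class_in_tuple_classes[OF window_tree_path]
    by (auto simp: flow_alphabet_def code_def reduced_linesD)
  have 2: "origin X (snd (code k f i)) = terminus X (snd (code k f (i - 1)))" for i
    using reduced_linesD[OF f, of i] reduced_linesD[OF f, of "i - 1"] by (simp add: code_def)
  have 3: "fst (code k f i) \<in> {edge_window k (code k f) i} \<times> tuple_classes X (edge_window k (code k f) i)" for i
    unfolding edge_window_code using path_class_in_tuple_classes[OF window_tree_path[OF f]]
    by (simp add: code_def)
  have 4: "pr1 (snd (fst (code k f i))) = pr2 (snd (fst (code k f (i + 1))))" for i
  proof -
    have "pr1 (snd (fst (code k f i))) = path_class n (\<lambda>j. window k f i (Suc j))"
      using w[of i 0] by (simp add: code_def pr1_def n tl_path_class)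
    moreover have "pr2 (snd (fst (code k f (i + 1)))) = path_class n (window k f (i + 1))"
      using w[of "i + 1" "Suc n"] by (simp add: code_def pr2_def n butlast_path_class)
    moreover have "(\<lambda>j. window k f i (Suc j)) = window k f (i + 1)"
      by (rule ext) (simp add: n window_Suc)
    ultimately show ?thesis by simp
  qed
  have 5: "pr3 (snd (fst (code k f i)))
            \<noteq> emb X (opposite X (snd (code k f i))) ` carrier (egroup X (snd (code k f i)))"
    if opp: "snd (code k f i) = opposite X (snd (code k f (i - 1)))" for i
  proof -
    have wn: "window k f i (Suc n) = f i" "window k f i n = f (i - 1)" by (simp_all add: window_def n)
    have "f i \<noteq> opposite T (f (i - 1))" using reduced_linesD(3)[OF f, of "i - 1"] by simp
    then show ?thesis
      using last_trivial_iff_backtrack[of n "window k f i"] w opp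
      unfolding wn by (simp add: code_def pr3_def n)
  qed
  show ?thesis
    unfolding geodesic_flow_def
    by (intro CollectI conjI allI impI) (use 1 in_topspace_full_shift in blast, rule 2, rule 3, rule 4, erule 5)
qed

text \<open>Needed for \<open>k = 1\<close>: windows then share a single edge and the projection
  condition is void, but the class of a one-edge path is always the same, so equality of orbits lets
  them be glued.\<close>

lemma path_class_0:
  assumes "p 0 \<in> edges T" shows "path_class 0 p = {[]}"
proof -
  obtain h where "h \<in> frames 0 p" using frames_nonempty[of 0 p] assms by auto
  then show ?thesis by (auto simp: path_class_def transitions_def)
qed

text \<open>Each letter lifts separately to a path \<open>P i\<close>. Elements \<open>g i\<close>
  fit \<open>P (i + 1)\<close> onto \<open>P i\<close> along their overlap, and their partial
  products \<open>d i\<close> move all the paths into one line.\<close>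

lemma code_onto_flow:
  assumes k: "k \<ge> 1" and s: "s \<in> geodesic_flow k X"
  obtains f where "f \<in> reduced_lines T" "code k f = s"
proof -
  obtain n where n: "k = Suc n" using k by (cases k) auto
  have alph: "s i \<in> flow_alphabet k X" for i
    using s by (auto simp: geodesic_flow_def in_topspace_full_shift)
  have "fst (s i) \<in> {edge_window k s i} \<times> tuple_classes X (edge_window k s i)" for i
    using s unfolding geodesic_flow_def by blast
  then have wnd: "fst (fst (s i)) = edge_window k s i" "snd (fst (s i)) \<in> tuple_classes X (edge_window k s i)" for i
    unfolding mem_Times_iff by blast+
  have pr12: "pr1 (snd (fst (s i))) = pr2 (snd (fst (s (i + 1))))" if "k \<ge> 2" for i
    using s that unfolding geodesic_flow_def by blast
  have nb: "pr3 (snd (fst (s i))) \<noteq> emb X (opposite X (snd (s i))) ` carrier (egroup X (snd (s i)))"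
    if "snd (s i) = opposite X (snd (s (i - 1)))" for i
    using s that unfolding geodesic_flow_def by blast
  have "edge_window k s i \<in> k_paths k X" for i
    using alph[of i] wnd(1)[of i] by (auto simp: flow_alphabet_def)
  then have "\<exists>p. tree_path k p \<and> orb_path k p = edge_window k s i \<and> path_class k p = snd (fst (s i))" for i
    using tuple_class_lifts[OF _ wnd(2)[of i]] by metis
  then obtain P where P: "\<And>i. tree_path k (P i)" "\<And>i. orb_path k (P i) = edge_window k s i"
    "\<And>i. path_class k (P i) = snd (fst (s i))" by metis
  have PE: "P i j \<in> edges T" if "j \<le> k" for i j using P(1)[of i] that by (simp add: tree_path_def)
  have orbP: "orb (P i j) = snd (s (i - int k + int j))" if "j \<le> k" for i j
  proof -
    have "orb (P i j) = edge_window k s i ! j" using that by (simp flip: P(2))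
    then show ?thesis using that by (simp add: edge_window_def del: upt_Suc)
  qed
  \<comment> \<open>The overlap has \<open>k = Suc n\<close> edges: entries \<open>0..n\<close> of
    the later window against \<open>1..Suc n\<close> of the earlier one.\<close>
  have "\<exists>g \<in> carrier G. \<forall>j\<le>n. snd g (P (i + 1) j) = P i (Suc j)" for i
  proof -
    have "path_class n (P (i + 1)) = path_class n (\<lambda>j. P i (Suc j))"
    proof (cases "n = 0")
      case True
      then show ?thesis using PE n by (simp add: path_class_0)
    next
      case False
      then have "pr1 (path_class (Suc n) (P i)) = pr2 (path_class (Suc n) (P (i + 1)))"
        using pr12[of i] by (simp add: n P(3)[unfolded n])
      then show ?thesis
        using tl_path_class[of "P i" n] butlast_path_class[of "P (i + 1)" n] PE n
        by (simp add: pr1_def pr2_def)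
    qed
    moreover have "orb_path n (P (i + 1)) = orb_path n (\<lambda>j. P i (Suc j))"
      using n orbP by (intro nth_equalityI) (simp_all add: algebra_simps)
    ultimately show ?thesis
      using same_class_imp_translate[of n "P (i + 1)" "\<lambda>j. P i (Suc j)"] PE n by (metis Suc_le_mono le_SucI)
  qed
  then obtain g where g: "\<And>i. g i \<in> carrier G" "\<And>i j. j \<le> n \<Longrightarrow> snd (g i) (P (i + 1) j) = P i (Suc j)"
    by metis
  obtain d where d: "\<And>i. d i \<in> carrier G" "\<And>i. d (i + 1) = d i \<cdot> g i"
    using G.int_product_exists[of g] g(1) by metis
  define f where "f = (\<lambda>i. snd (d i) (P i k))"
  \<comment> \<open>One step back in window \<open>i\<close> is the same edge seen one place later
    in window \<open>i - 1\<close>, because \<open>d i = d (i - 1) \<cdot> g (i - 1)\<close>. After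
    \<open>m\<close> steps the edge is the last one of window \<open>i - m\<close>, which defines
    \<open>f (i - m)\<close>.\<close>
  have glue: "snd (d i) (P i (k - m)) = f (i - int m)" if "m \<le> k" for i m
    using that
  proof (induction m arbitrary: i)
    case (Suc m)
    have "k - Suc m \<le> n" "Suc (k - Suc m) = k - m" using Suc.prems n by auto
    then have "snd (g (i - 1)) (P i (k - Suc m)) = P (i - 1) (k - m)"
      using g(2)[of "k - Suc m" "i - 1"] by simp
    then have "snd (d i) (P i (k - Suc m)) = snd (d (i - 1)) (P (i - 1) (k - m))"
      using d(2)[of "i - 1"] d(1) g(1) PE by simp
    then show ?case using Suc by (simp add: algebra_simps)
  qed (simp add: f_def)
  have win: "window k f i j = snd (d i) (P i j)" if "j \<le> k" for i j
    using glue[of "k - j" i] that by (simp add: window_def algebra_simps of_nat_diff)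
  have cls: "path_class k (window k f i) = snd (fst (s i))" for i
    using path_class_act[of k "P i" "d i"] d PE P(3) win by (simp cong: path_class_cong)
  have fE: "f i \<in> edges T" "orb (f i) = snd (s i)" for i
    using orbP[of k i] d PE by (simp_all add: f_def)
  \<comment> \<open>Two consecutive edges of \<open>f\<close> lie in one translated path, so
    adjacency can be read off there.\<close>
  have last2: "f (i + 1) = snd (d (i + 1)) (P (i + 1) (Suc n))" "f i = snd (d (i + 1)) (P (i + 1) n)" for i
    using glue[of 0 "i + 1"] glue[of 1 "i + 1"] n by simp_all
  have "f \<in> reduced_lines T"
    unfolding reduced_lines_def
  proof (intro CollectI allI conjI)
    fix i
    show "f i \<in> edges T" by (rule fE)
    have "terminus T (P (i + 1) n) = origin T (P (i + 1) (Suc n))"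
      using P(1)[of "i + 1"] n by (simp add: tree_path_def)
    then show "terminus T (f i) = origin T (f (i + 1))"
      unfolding last2[of i] using d(1) PE n by (simp del: d(2))
    have wn: "window k f (i + 1) (Suc n) = f (i + 1)" "window k f (i + 1) n = f i"
      by (simp_all add: window_def n)
    show "f (i + 1) \<noteq> opposite T (f i)"
    proof
      assume opp: "f (i + 1) = opposite T (f i)"
      then have "snd (s (i + 1)) = opposite X (snd (s i))" using fE(1)[of i] by (simp flip: fE(2))
      then have triv: "pr3 (snd (fst (s (i + 1)))) \<noteq>
          emb X (opposite X (orb (f (i + 1)))) ` carrier (egroup X (orb (f (i + 1))))"
        using nb[of "i + 1"] unfolding fE(2) by (simp only: add_diff_cancel_right' simp_thms)
      have "\<forall>j\<le>Suc n. window k f (i + 1) j \<in> edges T" by (simp add: window_def fE)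
      moreover have "orb (f (i + 1)) = opposite X (orb (f i))" using opp fE(1)[of i] by simp
      ultimately have "last ` path_class (Suc n) (window k f (i + 1)) =
          emb X (opposite X (orb (f (i + 1)))) ` carrier (egroup X (orb (f (i + 1))))"
        using last_trivial_iff_backtrack[of n "window k f (i + 1)", unfolded wn] opp by blast
      then show False
        using triv cls[of "i + 1"] unfolding pr3_def n by (simp only: simp_thms)
    qed
  qed
  moreover have "code k f = s"
  proof
    fix i
    have "orb_path k (window k f i) = edge_window k s i"
      by (simp add: edge_window_def orb_path_def window_def fE)
    then show "code k f i = s i"
      using cls[of i] wnd(1)[of i] fE(2)[of i] by (simp add: code_def prod_eq_iff)
  qed
  ultimately show ?thesis by (rule that)
qed

section \<open>Rigidity of windows from acylindricity\<close>

lemma one_graph_aut: "\<one>\<^bsub>graph_aut T\<^esub> = \<one>\<^bsub>G\<^esub>"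
  by (simp add: aut_subgroup_def)

text \<open>The element \<open>iv g \<cdot> g'\<close> fixes each edge of a reduced path of length
  \<open>k\<close>, so it is trivial.\<close>

lemma acylindrical_unique:
  assumes acyl: "acylindrical k T \<Gamma>" and f: "f \<in> reduced_lines T"
    and g: "g \<in> carrier G" "g' \<in> carrier G"
    and eq: "\<And>j. j < k \<Longrightarrow> snd g (f (a + int j)) = snd g' (f (a + int j))"
  shows "g = g'"
proof -
  define es where "es = map (\<lambda>j. f (a + int j)) [0..<k]"
  have "edge_path T es" "reduced T es" "length es = k"
    using reduced_linesD[OF f]
    by (auto simp: es_def edge_path_def reduced_def successively_conv_nth simp flip: add.assoc)
      (metis add.assoc add.commute)+
  then have "{g \<in> \<Gamma>. \<forall>e \<in> set es. snd g e = e} = {\<one>\<^bsub>G\<^esub>}"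
    using acyl unfolding acylindrical_def one_graph_aut by blast
  moreover have "iv g \<cdot> g' \<in> carrier G" using g by simp
  moreover have "snd (iv g \<cdot> g') e = e" if e: "e \<in> set es" for e
  proof -
    obtain j where "j < k" "e = f (a + int j)" using e by (auto simp: es_def)
    then show ?thesis using g eq[of j] reduced_linesD(1)[OF f] act_inv(1)[of g e] by simp
  qed
  ultimately have "iv g \<cdot> g' = \<one>\<^bsub>G\<^esub>" unfolding carrier_G by blast
  then have "g \<cdot> (iv g \<cdot> g') = g" using g by simp
  then show ?thesis using g by simp
qed

definition moves :: "nat \<Rightarrow> ('v \<Rightarrow> 'v) \<times> ('e \<Rightarrow> 'e) \<Rightarrow> (int \<Rightarrow> 'e) \<Rightarrow> (int \<Rightarrow> 'e) \<Rightarrow> int \<Rightarrow> bool" where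
  "moves k g f f' i \<longleftrightarrow> (\<forall>j\<le>k. snd g (window k f i j) = window k f' i j)"

lemma code_eq_imp_moves:
  assumes "f \<in> reduced_lines T" "f' \<in> reduced_lines T" "code k f i = code k f' i"
  obtains g where "g \<in> carrier G" "moves k g f f' i"
  using same_class_imp_translate[of k "window k f i" "window k f' i"] assms window_tree_path
  unfolding moves_def code_def tree_path_def by (metis Pair_inject)

text \<open>Equality of letters at \<open>i'\<close> provides some element for that window; it
  agrees with \<open>g\<close> on the \<open>k\<close> shared edges and hence equals
  \<open>g\<close>.\<close>

lemma moves_adjacent:
  assumes k: "k \<ge> 1" and acyl: "acylindrical k T \<Gamma>"
    and f: "f \<in> reduced_lines T" "f' \<in> reduced_lines T" and g: "g \<in> carrier G" "moves k g f f' i"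
    and i': "i' = i + 1 \<or> i' = i - 1" "code k f i' = code k f' i'"
  shows "moves k g f f' i'"
proof -
  obtain g' where g': "g' \<in> carrier G" "moves k g' f f' i'"
    using code_eq_imp_moves f i'(2) by blast
  have m: "snd g (f m) = f' m" if "i - int k \<le> m" "m \<le> i" for m
    using g(2)[unfolded moves_def window_def, rule_format, of "nat (m - i + int k)"] that by simp
  have m': "snd g' (f m) = f' m" if "i' - int k \<le> m" "m \<le> i'" for m
    using g'(2)[unfolded moves_def window_def, rule_format, of "nat (m - i' + int k)"] that by simp
  have "g = g'"
  proof (rule acylindrical_unique[OF acyl f(1) g(1) g'(1)])
    fix j assume "j < k"
    \<comment> \<open>Windows end at their index, so the shared edges run from
      \<open>max i i' - k\<close> to \<open>max i i' - 1\<close> in both cases.\<close>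
    then show "snd g (f (max i i' - int k + int j)) = snd g' (f (max i i' - int k + int j))"
      using i'(1) m[of "max i i' - int k + int j"] m'[of "max i i' - int k + int j"] by auto
  qed
  then show ?thesis using g' by simp
qed

text \<open>\<open>moves_adjacent\<close> propagates the element of window 0 in both directions. The
  finite range is the form needed for openness of the coding, where only finitely many letters are
  known to agree.\<close>

lemma code_eq_imp_translate:
  assumes k: "k \<ge> 1" and acyl: "acylindrical k T \<Gamma>"
    and f: "f \<in> reduced_lines T" "f' \<in> reduced_lines T" and g: "g \<in> carrier G" "moves k g f f' 0"
    and eq: "\<And>i. \<bar>i\<bar> \<le> int n \<Longrightarrow> code k f i = code k f' i" and i: "\<bar>i\<bar> \<le> int n"
  shows "snd g (f i) = f' i"
proof -
  have up: "moves k g f f' (int m)" if "m \<le> n" for m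
    using that
  proof (induction m)
    case (Suc m)
    then show ?case
      using moves_adjacent[OF k acyl f g(1), of "int m" "int (Suc m)"] eq[of "int (Suc m)"] by simp
  qed (use g in simp)
  have down: "moves k g f f' (- int m)" if "m \<le> n" for m
    using that
  proof (induction m)
    case (Suc m)
    then show ?case
      using moves_adjacent[OF k acyl f g(1), of "- int m" "- int (Suc m)"] eq[of "- int (Suc m)"] by simp
  qed (use g in simp)
  have "moves k g f f' i"
    using up[of "nat i"] down[of "nat (- i)"] i by (cases "i \<ge> 0") auto
  then show ?thesis using window_end unfolding moves_def by (metis order_refl)
qed

lemma code_window_cong:
  assumes "\<And>j. i - int k \<le> j \<Longrightarrow> j \<le> i \<Longrightarrow> f j = f' j"
  shows "code k f i = code k f' i"
proof -
  have "window k f i j = window k f' i j" if "j \<le> k" for j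
    using assms that by (simp add: window_def)
  then show ?thesis
    using assms[of i] by (simp add: code_def orb_path_def cong: path_class_cong)
qed

end

section \<open>Neighbourhoods in sequence spaces\<close>

lemma finite_int_set_bounded:
  fixes F :: "int set"
  assumes "finite F" obtains n :: nat where "\<And>i. i \<in> F \<Longrightarrow> \<bar>i\<bar> \<le> int n"
proof
  fix i assume "i \<in> F"
  then have "nat \<bar>i\<bar> \<le> (\<Sum>i\<in>F. nat \<bar>i\<bar>)" using assms by (intro member_le_sum) auto
  then show "\<bar>i\<bar> \<le> int (\<Sum>i\<in>F. nat \<bar>i\<bar>)" by linarith
qed

text \<open>A basic open set of the product restricts finitely many coordinates, all inside some
  interval from \<open>- n\<close> to \<open>n\<close>; with a discrete alphabet each of them can be
  restricted to one letter.\<close>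

lemma openin_full_shift:
  "openin (full_shift A) U \<longleftrightarrow> U \<subseteq> topspace (full_shift A) \<and>
    (\<forall>s\<in>U. \<exists>n. \<forall>s'\<in>topspace (full_shift A). (\<forall>i. \<bar>i\<bar> \<le> int n \<longrightarrow> s' i = s i) \<longrightarrow> s' \<in> U)"
    (is "_ \<longleftrightarrow> ?R")
proof
  assume U: "openin (full_shift A) U"
  show ?R
  proof (intro conjI ballI)
    show "U \<subseteq> topspace (full_shift A)" using U by (rule openin_subset)
    fix s assume "s \<in> U"
    then obtain B where B: "finite {i. B i \<noteq> A}" "s \<in> Pi\<^sub>E UNIV B" "Pi\<^sub>E UNIV B \<subseteq> U"
      using U unfolding full_shift_def openin_product_topology_alt by auto
    obtain n where n: "\<And>i. B i \<noteq> A \<Longrightarrow> \<bar>i\<bar> \<le> int n"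
      using finite_int_set_bounded[OF B(1)] by auto
    have "s' \<in> U" if "s' \<in> topspace (full_shift A)" "\<forall>i. \<bar>i\<bar> \<le> int n \<longrightarrow> s' i = s i" for s'
    proof -
      have "s' i \<in> B i" for i
        using that B(2) n[of i] by (cases "B i = A") (auto simp: in_topspace_full_shift PiE_UNIV_domain)
      then show ?thesis using B(3) by (auto simp: PiE_UNIV_domain)
    qed
    then show "\<exists>n. \<forall>s'\<in>topspace (full_shift A). (\<forall>i. \<bar>i\<bar> \<le> int n \<longrightarrow> s' i = s i) \<longrightarrow> s' \<in> U"
      by blast
  qed
next
  assume R: ?R
  have "\<exists>B. finite {i \<in> UNIV. B i \<noteq> topspace (discrete_topology A)} \<and>
      (\<forall>i\<in>UNIV. openin (discrete_topology A) (B i)) \<and> s \<in> Pi\<^sub>E UNIV B \<and> Pi\<^sub>E UNIV B \<subseteq> U"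
    if s: "s \<in> U" for s
  proof -
    obtain n where n: "\<And>s'. s' \<in> topspace (full_shift A) \<Longrightarrow> (\<And>i. \<bar>i\<bar> \<le> int n \<Longrightarrow> s' i = s i) \<Longrightarrow> s' \<in> U"
      using R s by meson
    define B where "B = (\<lambda>i. if \<bar>i\<bar> \<le> int n then {s i} else A)"
    have sA: "s i \<in> A" for i using R s by (auto simp: in_topspace_full_shift)
    have "{i. B i \<noteq> A} \<subseteq> {- int n..int n}" by (auto simp: B_def)
    then have "finite {i. B i \<noteq> A}" by (rule finite_subset) simp
    moreover have "Pi\<^sub>E UNIV B \<subseteq> U"
    proof
      fix s' assume "s' \<in> Pi\<^sub>E UNIV B"
      then have s': "s' i \<in> B i" for i by (auto simp: PiE_UNIV_domain)
      have "s' i \<in> A" for i using s'[of i] sA[of i] by (auto simp: B_def split: if_splits)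
      moreover have "s' i = s i" if "\<bar>i\<bar> \<le> int n" for i using s'[of i] that by (simp add: B_def)
      ultimately show "s' \<in> U" using n by (simp add: in_topspace_full_shift)
    qed
    moreover have "s \<in> Pi\<^sub>E UNIV B" "B i \<subseteq> A" for i
      using sA by (auto simp: B_def PiE_UNIV_domain)
    ultimately show ?thesis by (intro exI[of _ B]) auto
  qed
  then show "openin (full_shift A) U" unfolding full_shift_def openin_product_topology_alt by blast
qed

lemma openin_subshift:
  assumes S: "S \<subseteq> topspace (full_shift A)"
  shows "openin (subtopology (full_shift A) S) U \<longleftrightarrow> U \<subseteq> S \<and>
    (\<forall>s\<in>U. \<exists>n. \<forall>s'\<in>S. (\<forall>i. \<bar>i\<bar> \<le> int n \<longrightarrow> s' i = s i) \<longrightarrow> s' \<in> U)"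
    (is "_ \<longleftrightarrow> ?R")
proof
  assume "openin (subtopology (full_shift A) S) U"
  then obtain V where V: "openin (full_shift A) V" "U = V \<inter> S" by (auto simp: openin_subtopology)
  show ?R
  proof (intro conjI ballI)
    show "U \<subseteq> S" using V by blast
    fix s assume "s \<in> U"
    then obtain n where "\<forall>s'\<in>topspace (full_shift A). (\<forall>i. \<bar>i\<bar> \<le> int n \<longrightarrow> s' i = s i) \<longrightarrow> s' \<in> V"
      using V unfolding openin_full_shift by blast
    then show "\<exists>n. \<forall>s'\<in>S. (\<forall>i. \<bar>i\<bar> \<le> int n \<longrightarrow> s' i = s i) \<longrightarrow> s' \<in> U"
      using V S by blast
  qed
next
  assume R: ?R
  then obtain n where n: "\<And>s s'. s \<in> U \<Longrightarrow> s' \<in> S \<Longrightarrow> (\<forall>i. \<bar>i\<bar> \<le> int (n s) \<longrightarrow> s' i = s i) \<Longrightarrow> s' \<in> U"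
    by metis
  \<comment> \<open>The union of the cylinders in the full shift around the points of
    \<open>U\<close>, each with its own radius \<open>n s\<close>; it meets \<open>S\<close> in
    \<open>U\<close>.\<close>
  define V where "V = {s' \<in> topspace (full_shift A). \<exists>s\<in>U. \<forall>i. \<bar>i\<bar> \<le> int (n s) \<longrightarrow> s' i = s i}"
  have "openin (full_shift A) V"
    unfolding openin_full_shift
  proof (intro conjI ballI)
    show "V \<subseteq> topspace (full_shift A)" by (auto simp: V_def)
    fix t assume "t \<in> V"
    then obtain s where s: "s \<in> U" "\<forall>i. \<bar>i\<bar> \<le> int (n s) \<longrightarrow> t i = s i" by (auto simp: V_def)
    then show "\<exists>n. \<forall>s'\<in>topspace (full_shift A). (\<forall>i. \<bar>i\<bar> \<le> int n \<longrightarrow> s' i = t i) \<longrightarrow> s' \<in> V"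
      by (intro exI[of _ "n s"]) (auto simp: V_def)
  qed
  moreover have "U = V \<inter> S" using R n S by (fastforce simp: V_def)
  ultimately show "openin (subtopology (full_shift A) S) U" by (auto simp: openin_subtopology)
qed

section \<open>The flow is a subshift\<close>

lemma geodesic_flow_in_full_shift: "geodesic_flow k X \<subseteq> topspace (full_shift (flow_alphabet k X))"
  by (auto simp: geodesic_flow_def)

lemma edge_window_left_shift: "edge_window k (left_shift s) i = edge_window k s (i + 1)"
  by (simp add: edge_window_def left_shift_def algebra_simps)

text \<open>The conditions at one index read finitely many letters, so their failure persists on a
  cylinder.\<close>

lemma closedin_geodesic_flow: "closedin (full_shift (flow_alphabet k X)) (geodesic_flow k X)"
proof -
  let ?S = "full_shift (flow_alphabet k X)"
  define P where "P = (\<lambda>s i. origin X (snd (s i)) = terminus X (snd (s (i - 1)))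
     \<and> fst (s i) \<in> {edge_window k s i} \<times> tuple_classes X (edge_window k s i)
     \<and> (k \<ge> 2 \<longrightarrow> pr1 (snd (fst (s i))) = pr2 (snd (fst (s (i + 1)))))
     \<and> (snd (s i) = opposite X (snd (s (i - 1))) \<longrightarrow>
          pr3 (snd (fst (s i)))
            \<noteq> emb X (opposite X (snd (s i))) ` carrier (egroup X (snd (s i)))))"
  have flow: "geodesic_flow k X = {s \<in> topspace ?S. \<forall>i. P s i}"
    by (simp add: geodesic_flow_def P_def)
  \<comment> \<open>The bound covers the window from \<open>i - k\<close> to \<open>i\<close> and
    the neighbours \<open>i - 1\<close> and \<open>i + 1\<close>.\<close>
  have cong: "P s' i = P s i" if "\<And>j. \<bar>j\<bar> \<le> \<bar>i\<bar> + int k + 1 \<Longrightarrow> s' j = s j" for s s' i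
  proof -
    have "edge_window k s' i = edge_window k s i"
      unfolding edge_window_def by (rule map_cong) (auto simp: that)
    moreover have "s' i = s i" "s' (i - 1) = s (i - 1)" "s' (i + 1) = s (i + 1)"
      by (rule that; simp)+
    ultimately show ?thesis by (simp add: P_def)
  qed
  have "openin ?S (topspace ?S - geodesic_flow k X)"
    unfolding openin_full_shift
  proof (intro conjI ballI)
    fix s assume "s \<in> topspace ?S - geodesic_flow k X"
    then obtain i where i: "\<not> P s i" by (auto simp: flow)
    have "s' \<in> topspace ?S - geodesic_flow k X"
      if s': "s' \<in> topspace ?S" "\<forall>j. \<bar>j\<bar> \<le> int (nat \<bar>i\<bar> + k + 1) \<longrightarrow> s' j = s j" for s'
    proof -
      have "\<not> P s' i" using i cong[of i s' s] s'(2) by simp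
      then show ?thesis using s'(1) by (auto simp: flow)
    qed
    then show "\<exists>n. \<forall>s'\<in>topspace ?S. (\<forall>i. \<bar>i\<bar> \<le> int n \<longrightarrow> s' i = s i) \<longrightarrow> s' \<in> topspace ?S - geodesic_flow k X"
      by blast
  qed auto
  then show ?thesis by (simp add: closedin_def geodesic_flow_in_full_shift)
qed

lemma left_shift_geodesic_flow_iff: "left_shift s \<in> geodesic_flow k X \<longleftrightarrow> s \<in> geodesic_flow k X"
proof -
  have all: "(\<forall>i. Q (i + 1)) \<longleftrightarrow> (\<forall>i. Q i)" for Q :: "int \<Rightarrow> bool"
    by (metis diff_add_cancel)
  show ?thesis
    unfolding geodesic_flow_def mem_Collect_eq in_topspace_full_shift edge_window_left_shift
    unfolding left_shift_def
    by (subst (1 2) all[symmetric]) (simp add: algebra_simps)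
qed

lemma subshift_geodesic_flow: "subshift (flow_alphabet k X) (geodesic_flow k X)"
proof -
  have "left_shift ` geodesic_flow k X = geodesic_flow k X"
  proof (intro equalityI subsetI)
    fix s assume s: "s \<in> geodesic_flow k X"
    have "s = left_shift (\<lambda>i. s (i - 1))" by (simp add: left_shift_def)
    then show "s \<in> left_shift ` geodesic_flow k X"
      using s left_shift_geodesic_flow_iff by (metis image_eqI)
  qed (auto simp: left_shift_geodesic_flow_iff)
  then show ?thesis by (simp add: subshift_def closedin_geodesic_flow)
qed

section \<open>Geodesics and reduced edge lines\<close>

lemma tree_no_loop:
  assumes "tree X" "e \<in> edges X" shows "terminus X e \<noteq> origin X e"
proof
  assume "terminus X e = origin X e"
  then have "circuit X [e]" using assms by (simp add: circuit_def edge_path_def reduced_def)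
  then show False using assms by (auto simp: tree_def)
qed

text \<open>Two distinct parallel edges would form a circuit: one followed by the opposite of the
  other. This is why edges can be recovered from the vertices of a geodesic.\<close>

lemma tree_edge_eqI:
  assumes T: "tree X" and e: "e \<in> edges X" "e' \<in> edges X"
    and eq: "origin X e = origin X e'" "terminus X e = terminus X e'"
  shows "e = e'"
proof (rule ccontr)
  assume ne: "e \<noteq> e'"
  have opp: "opposite X d \<in> edges X" "opposite X (opposite X d) = d" if "d \<in> edges X" for d
    using T that by (auto simp: tree_def serre_graph_def)
  have "opposite X e' \<noteq> opposite X e" using ne opp e by metis
  then have "circuit X [e, opposite X e']"
    using e eq opp tree_no_loop[OF T e(1)]
    by (auto simp: circuit_def edge_path_def reduced_def terminus_def)
  then show False using T by (auto simp: tree_def)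
qed

text \<open>A shortest segment returning to its starting vertex would be a circuit; the induction
  hypothesis on shorter segments makes its vertices distinct.\<close>

lemma reduced_line_inj:
  assumes T: "tree X" and f: "f \<in> reduced_lines X"
  shows "inj (\<lambda>i. origin X (f i))"
proof -
  note fD = reduced_linesD[OF f]
  have "origin X (f i) \<noteq> origin X (f (i + int (Suc m)))" for m i
  proof (induction m arbitrary: i rule: less_induct)
    case (less m)
    define es where "es = map (\<lambda>j. f (i + int j)) [0..<Suc m]"
    show ?case
    proof
      assume eq: "origin X (f i) = origin X (f (i + int (Suc m)))"
      have "edge_path X es" "reduced X es"
        using fD(1) fD(2)[of "i + int _"] fD(3)[of "i + int _"]
        by (auto simp: es_def edge_path_def reduced_def successively_conv_nth ac_simps simp del: upt_Suc)
      moreover have "hd es = f i" "last es = f (i + int m)"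
        by (simp_all add: es_def upt_conv_Cons[of 0] last_map del: upt_Suc)
      then have "terminus X (last es) = origin X (hd es)"
        using fD(2)[of "i + int m"] eq by (simp add: ac_simps)
      moreover have "distinct (map (origin X) es)"
        unfolding distinct_conv_nth
      proof (intro allI impI)
        fix a b assume ab: "a < length (map (origin X) es)" "b < length (map (origin X) es)" "a \<noteq> b"
        \<comment> \<open>The distance \<open>b - a\<close> is the successor of
          \<open>b - Suc a\<close>, which is less than \<open>m\<close>.\<close>
        have *: "origin X (f (i + int a)) \<noteq> origin X (f (i + int b))" if "a < b" "b \<le> m" for a b
          using less.IH[of "b - Suc a" "i + int a"] that by (simp add: algebra_simps of_nat_diff)
        show "map (origin X) es ! a \<noteq> map (origin X) es ! b"
          using ab *[of a b] *[of b a] by (auto simp: es_def nat_neq_iff simp del: upt_Suc)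
      qed
      ultimately have "circuit X es" by (simp add: circuit_def es_def)
      then show False using T by (auto simp: tree_def)
    qed
  qed
  then have lt: "origin X (f i) \<noteq> origin X (f j)" if "i < j" for i j
    using that by (metis zless_iff_Suc_zadd)
  show ?thesis by (rule injI) (metis lt linorder_neqE)
qed

section \<open>Affine lines in the realization\<close>

definition affine_line :: "(int \<Rightarrow> 'v) \<Rightarrow> real \<Rightarrow> 'v \<Rightarrow> real" where
  "affine_line v t = (\<lambda>w. (1 - frac t) * vertex_point (v \<lfloor>t\<rfloor>) w + frac t * vertex_point (v (\<lfloor>t\<rfloor> + 1)) w)"

definition edge_line :: "('v, 'e, 'm) serre_graph_scheme \<Rightarrow> (int \<Rightarrow> 'e) \<Rightarrow> real \<Rightarrow> 'v \<Rightarrow> real" where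
  "edge_line X f = affine_line (\<lambda>i. origin X (f i))"

lemma vertex_point_eq_iff: "vertex_point v = vertex_point w \<longleftrightarrow> v = w"
  by (metis vertex_point_def zero_neq_one)

lemma affine_line_of_int: "affine_line v (of_int n) = vertex_point (v n)"
  by (simp add: affine_line_def)

lemma affine_line_add:
  assumes "u \<in> {0..1}"
  shows "affine_line v (of_int n + u) =
    (\<lambda>w. (1 - u) * vertex_point (v n) w + u * vertex_point (v (n + 1)) w)"
\<comment> \<open>At \<open>u = 1\<close> the floor jumps to \<open>n + 1\<close>; the formula
  survives because both pieces take the same vertex value.\<close>
proof (cases "u = 1")
  case True
  then show ?thesis using affine_line_of_int[of v "n + 1"] by simp
next
  case False
  then have "\<lfloor>of_int n + u\<rfloor> = n" "frac (of_int n + u) = u"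
    using assms by (auto simp: floor_eq_iff frac_def)
  then show ?thesis by (simp add: affine_line_def)
qed

lemma affine_line_shift: "affine_line (\<lambda>i. v (i + 1)) t = affine_line v (t + 1)"
  by (simp add: affine_line_def frac_def)

text \<open>The coordinate at the vertex with index \<open>\<lfloor>s\<rfloor>\<close> is
  \<open>1 - frac s\<close>, which is positive. So at a common point each floor is the other or its
  successor; by symmetry the floors agree, and the coordinate then determines the fractional
  part.\<close>

lemma affine_line_inj:
  assumes "inj v" shows "inj (affine_line v)"
proof (rule injI)
  have v: "v i = v j \<longleftrightarrow> i = j" for i j using assms by (auto dest: injD)
  have floor: "\<lfloor>s\<rfloor> = \<lfloor>t\<rfloor> \<or> \<lfloor>s\<rfloor> = \<lfloor>t\<rfloor> + 1" if "affine_line v s = affine_line v t" for s t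
  proof -
    have "affine_line v s (v \<lfloor>s\<rfloor>) > 0"
      using frac_lt_1[of s] by (simp add: affine_line_def vertex_point_def v)
    then have "affine_line v t (v \<lfloor>s\<rfloor>) > 0" by (simp add: that)
    then show ?thesis by (auto simp: affine_line_def vertex_point_def v split: if_splits)
  qed
  fix s t assume eq: "affine_line v s = affine_line v t"
  have f: "\<lfloor>s\<rfloor> = \<lfloor>t\<rfloor>" using floor[OF eq] floor[OF eq[symmetric]] by auto
  have "affine_line v s (v \<lfloor>s\<rfloor>) = affine_line v t (v \<lfloor>t\<rfloor>)" by (simp add: eq f)
  then have "frac s = frac t" by (simp add: affine_line_def vertex_point_def v)
  then show "s = t" using f by (simp add: frac_def)
qed

lemma cell_edge:
  assumes "a \<noteq> b" "u \<in> {0..1}"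
  shows "(\<lambda>w. (1 - u) * vertex_point a w + u * vertex_point b w) \<in> cell {a, b}"
  using assms by (auto simp: cell_def vertex_point_def)

lemma topspace_realization: "topspace (realization X) = (\<Union>s \<in> simplices X. cell s)"
proof
  have "openin (realization X) (\<Union>s \<in> simplices X. cell s)"
    unfolding openin_realization
  proof (intro conjI ballI)
    fix s assume "s \<in> simplices X"
    then have "(\<Union>s \<in> simplices X. cell s) \<inter> cell s = cell s" by blast
    then show "openin (top_of_set (cell s)) ((\<Union>s \<in> simplices X. cell s) \<inter> cell s)"
      by simp
  qed simp
  then show "(\<Union>s \<in> simplices X. cell s) \<subseteq> topspace (realization X)" by (rule openin_subset)
  show "topspace (realization X) \<subseteq> (\<Union>s \<in> simplices X. cell s)"
    using openin_realization[of X "topspace (realization X)"] by simp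
qed

text \<open>The weak topology makes the inclusion of each cell continuous.\<close>

lemma continuous_map_into_cell:
  assumes s: "s \<in> simplices X" and f: "continuous_map Y (top_of_set (cell s)) f"
  shows "continuous_map Y (realization X) f"
  unfolding continuous_map_def
proof (intro conjI allI impI)
  have im: "f y \<in> cell s" if "y \<in> topspace Y" for y
    using f that by (auto simp: continuous_map_def)
  then show "f \<in> topspace Y \<rightarrow> topspace (realization X)"
    using s by (auto simp: topspace_realization)
  fix U assume "openin (realization X) U"
  then have "openin (top_of_set (cell s)) (U \<inter> cell s)" using s by (simp add: openin_realization)
  then have "openin Y {y \<in> topspace Y. f y \<in> U \<inter> cell s}"
    using f by (intro openin_continuous_map_preimage)
  moreover have "{y \<in> topspace Y. f y \<in> U \<inter> cell s} = {y \<in> topspace Y. f y \<in> U}" using im by auto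
  ultimately show "openin Y {y \<in> topspace Y. f y \<in> U}" by simp
qed

lemma edge_line_segment:
  assumes T: "tree X" and f: "f \<in> reduced_lines X" and t: "t \<in> {of_int n..of_int n + 1}"
  shows "edge_line X f t = (\<lambda>w. (1 - (t - of_int n)) * vertex_point (origin X (f n)) w
      + (t - of_int n) * vertex_point (terminus X (f n)) w)"
    and "edge_line X f t \<in> cell {origin X (f n), terminus X (f n)}"
    and "{origin X (f n), terminus X (f n)} \<in> simplices X"
proof -
  note fD = reduced_linesD[OF f]
  show eq: "edge_line X f t = (\<lambda>w. (1 - (t - of_int n)) * vertex_point (origin X (f n)) w
      + (t - of_int n) * vertex_point (terminus X (f n)) w)"
    using affine_line_add[of "t - of_int n" "\<lambda>i. origin X (f i)" n] t
    by (simp add: edge_line_def fD(2))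
  show "edge_line X f t \<in> cell {origin X (f n), terminus X (f n)}"
    unfolding eq using tree_no_loop[OF T fD(1)[of n]] t by (intro cell_edge) auto
  show "{origin X (f n), terminus X (f n)} \<in> simplices X"
    using fD(1)[of n] by (auto simp: simplices_def)
qed

text \<open>On a closed unit interval the line stays in one cell, where continuity is checked
  coordinatewise; these intervals form a locally finite cover, so the pieces can be pasted.\<close>

lemma continuous_edge_line:
  assumes T: "tree X" and f: "f \<in> reduced_lines X"
  shows "continuous_map euclidean (realization X) (edge_line X f)"
proof (rule pasting_lemma_locally_finite[where I = "UNIV :: int set" and f = "\<lambda>_. edge_line X f"
      and T = "\<lambda>n. {of_int n..of_int n + 1}"])
  fix x :: real
  have "finite {n::int. {of_int n..of_int n + 1} \<inter> {x - 1<..<x + 1} \<noteq> {}}"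
  proof (rule finite_subset)
    show "{n::int. {of_int n..of_int n + 1} \<inter> {x - 1<..<x + 1} \<noteq> {}} \<subseteq> {\<lfloor>x\<rfloor> - 2..\<lfloor>x\<rfloor> + 2}"
    proof
      fix n :: int assume "n \<in> {n::int. {of_int n..of_int n + 1} \<inter> {x - 1<..<x + 1} \<noteq> {}}"
      then have "of_int n < x + 1" "x - 2 < of_int n" by auto
      then show "n \<in> {\<lfloor>x\<rfloor> - 2..\<lfloor>x\<rfloor> + 2}" by auto linarith+
    qed
  qed simp
  then show "\<exists>V. openin euclidean V \<and> x \<in> V \<and> finite {n \<in> (UNIV :: int set). {of_int n..of_int n + 1} \<inter> V \<noteq> {}}"
    by (intro exI[of _ "{x - 1<..<x + 1}"]) auto
next
  fix n :: int
  let ?I = "{of_int n..of_int n + 1 :: real}"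
  have "continuous_on ?I (\<lambda>t w. (1 - (t - of_int n)) * vertex_point (origin X (f n)) w
      + (t - of_int n) * vertex_point (terminus X (f n)) w)"
    by (intro continuous_on_coordinatewise_then_product continuous_intros)
  then have "continuous_on ?I (edge_line X f)"
    by (rule continuous_on_eq) (simp add: edge_line_segment(1)[OF T f])
  then have "continuous_map (top_of_set ?I) (top_of_set (cell {origin X (f n), terminus X (f n)})) (edge_line X f)"
    using edge_line_segment(2)[OF T f] by auto
  then show "continuous_map (top_of_set ?I) (realization X) (edge_line X f)"
    by (rule continuous_map_into_cell[rotated]) (rule edge_line_segment(3)[OF T f, of "of_int n"], simp)
next
  fix x :: real
  have "x \<in> {of_int \<lfloor>x\<rfloor>..of_int \<lfloor>x\<rfloor> + 1}" by simp
  then show "\<exists>j. j \<in> (UNIV :: int set) \<and> x \<in> {of_int j..of_int j + 1} \<and> edge_line X f x = edge_line X f x"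
    by blast
qed auto

lemma topspace_compact_open: "topspace (compact_open_topology Y) = {f. continuous_map euclidean Y f}"
proof -
  have "{f. continuous_map euclidean Y f} \<in>
      {{f. continuous_map euclidean Y f \<and> f ` K \<subseteq> U} |(K :: 'a set) U. compact K \<and> openin Y U}"
    \<comment> \<open>With \<open>K\<close> and \<open>U\<close> empty the subbasic condition is
      void.\<close>
    by (rule CollectI, rule exI[of _ "{}"], rule exI[of _ "{}"]) simp
  then show ?thesis
    unfolding compact_open_topology_def topology_generated_by_topspace by blast
qed

lemma topspace_geodesics:
  "topspace (geodesics X) = {f. continuous_map euclidean (realization X) f \<and> simplicial_line X f \<and> inj f}"
  by (auto simp: geodesics_def topspace_compact_open)

lemma simplicial_edge_line:
  assumes T: "tree X" and f: "f \<in> reduced_lines X"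
  shows "simplicial_line X (edge_line X f)"
  unfolding simplicial_line_def
proof (intro allI conjI ballI)
  note fD = reduced_linesD[OF f]
  fix n :: int
  have "origin X (f n) \<in> verts X" using T fD(1) by (auto simp: tree_def serre_graph_def)
  then show "edge_line X f (of_int n) \<in> vertex_point ` verts X"
    by (simp add: edge_line_def affine_line_of_int)
  show "\<exists>s\<in>simplices X. edge_line X f (of_int n) \<in> cell s \<and> edge_line X f (of_int (n + 1)) \<in> cell s"
    using edge_line_segment(2,3)[OF T f, of "of_int n" n] edge_line_segment(2)[OF T f, of "of_int (n + 1)" n]
    by auto
  fix u :: real assume u: "u \<in> {0..1}"
  show "edge_line X f (of_int n + u) =
      (\<lambda>v. (1 - u) * edge_line X f (of_int n) v + u * edge_line X f (of_int (n + 1)) v)"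
    unfolding edge_line_def affine_line_of_int by (rule affine_line_add[OF u])
qed

lemma edge_line_in_geodesics:
  assumes T: "tree X" and f: "f \<in> reduced_lines X"
  shows "edge_line X f \<in> topspace (geodesics X)"
  using continuous_edge_line[OF T f] simplicial_edge_line[OF T f] affine_line_inj[OF reduced_line_inj[OF T f]]
  by (simp add: topspace_geodesics edge_line_def)

text \<open>Injectivity makes the vertices at \<open>n\<close> and \<open>n + 1\<close> distinct, so
  their common simplex is an edge, which is then oriented along the line. Backtracking would repeat
  the vertex at \<open>n\<close> at \<open>n + 2\<close>.\<close>

lemma geodesic_is_edge_line:
  assumes T: "tree X" and g: "g \<in> topspace (geodesics X)"
  obtains f where "f \<in> reduced_lines X" "g = edge_line X f"
proof -
  have simp: "simplicial_line X g" and inj: "inj g" using g by (auto simp: topspace_geodesics)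
  have "\<exists>v. g (of_int n) = vertex_point v" for n :: int using simp by (auto simp: simplicial_line_def)
  then obtain v where v: "\<And>n::int. g (of_int n) = vertex_point (v n)" by metis
  have vinj: "v m = v n \<longleftrightarrow> m = n" for m n
    using inj v by (metis injD of_int_eq_iff)
  have "\<exists>e \<in> edges X. origin X e = v n \<and> terminus X e = v (n + 1)" for n
  proof -
    obtain s where s: "s \<in> simplices X" "g (of_int n) \<in> cell s" "g (of_int (n + 1)) \<in> cell s"
      using simp unfolding simplicial_line_def by meson
    have "v n \<in> s" "v (n + 1) \<in> s" using s(2,3) unfolding v by (auto simp: cell_def vertex_point_def)
    moreover have "v n \<noteq> v (n + 1)" by (simp add: vinj)
    ultimately obtain e where e: "e \<in> edges X" "s = {origin X e, terminus X e}"
      using s(1) by (auto simp: simplices_def)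
    have vs: "{v n, v (n + 1)} = {origin X e, terminus X e}"
      using \<open>v n \<in> s\<close> \<open>v (n + 1) \<in> s\<close> \<open>v n \<noteq> v (n + 1)\<close> e(2) by auto
    have "opposite X e \<in> edges X" "terminus X (opposite X e) = origin X e"
      using T e(1) by (auto simp: tree_def serre_graph_def terminus_def)
    moreover have "origin X (opposite X e) = terminus X e" by (simp add: terminus_def)
    ultimately show ?thesis using e(1) vs by (metis doubleton_eq_iff)
  qed
  then obtain f where f: "\<And>n. f n \<in> edges X" "\<And>n. origin X (f n) = v n" "\<And>n. terminus X (f n) = v (n + 1)"
    by metis
  have "f (n + 1) \<noteq> opposite X (f n)" for n
  proof
    assume "f (n + 1) = opposite X (f n)"
    then have "terminus X (f (n + 1)) = origin X (f n)"
      using T f(1)[of n] by (simp add: tree_def serre_graph_def terminus_def)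
    then show False by (simp add: f vinj)
  qed
  then have "f \<in> reduced_lines X" by (simp add: reduced_lines_def f)
  moreover have "g = edge_line X f"
  proof
    fix t :: real
    have "frac t \<in> {0..1}" using frac_lt_1[of t] by (simp add: less_imp_le)
    then have "g (of_int \<lfloor>t\<rfloor> + frac t) = (\<lambda>w. (1 - frac t) * g (of_int \<lfloor>t\<rfloor>) w + frac t * g (of_int (\<lfloor>t\<rfloor> + 1)) w)"
      using simp unfolding simplicial_line_def by blast
    then show "g t = edge_line X f t"
      unfolding v by (simp add: edge_line_def affine_line_def f frac_def)
  qed
  ultimately show ?thesis by (rule that)
qed

lemma edge_eq_if_endpoints_eq:
  assumes T: "tree X" and f: "f \<in> reduced_lines X" "f' \<in> reduced_lines X"
    and "origin X (f i) = origin X (f' i)" "origin X (f (i + 1)) = origin X (f' (i + 1))"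
  shows "f i = f' i"
  using assms by (intro tree_edge_eqI[OF T]) (simp_all add: reduced_linesD)

lemma edge_line_eqD:
  assumes T: "tree X" and f: "f \<in> reduced_lines X" "f' \<in> reduced_lines X"
    and eq: "edge_line X f = edge_line X f'"
  shows "f = f'"
proof
  have "origin X (f i) = origin X (f' i)" for i
    using fun_cong[OF eq, of "of_int i"] by (simp add: edge_line_def affine_line_of_int vertex_point_eq_iff)
  then show "f i = f' i" for i using edge_eq_if_endpoints_eq[OF T f] by blast
qed

section \<open>Finite windows and the compact-open topology\<close>

text \<open>For a vertex \<open>v\<close> this is a neighbourhood without other vertices, since
  coordinates of vertex points are 0 or 1. Its trace on each cell is cut out by a continuous
  coordinate, whatever the valence of \<open>v\<close>.\<close>

lemma open_star:
  "openin (realization X) {x \<in> topspace (realization X). x v > 1/2}"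
  unfolding openin_realization
proof (intro conjI ballI)
  fix s assume s: "s \<in> simplices X"
  have "open {x :: 'a \<Rightarrow> real. x v > 1/2}"
    by (intro open_Collect_less continuous_on_const continuous_on_product_coordinates)
  then have "openin (top_of_set (cell s)) (cell s \<inter> {x. x v > 1/2})" by (rule openin_open_Int)
  moreover have "{x \<in> topspace (realization X). x v > 1/2} \<inter> cell s = cell s \<inter> {x. x v > 1/2}"
    using s by (auto simp: topspace_realization)
  ultimately show "openin (top_of_set (cell s)) ({x \<in> topspace (realization X). x v > 1/2} \<inter> cell s)"
    by simp
qed (auto simp: topspace_realization)

lemma edge_line_cong:
  assumes "\<And>i. \<bar>i\<bar> \<le> int n + 1 \<Longrightarrow> f i = f' i" "\<bar>t\<bar> \<le> real n"
  shows "edge_line X f t = edge_line X f' t"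
proof -
  \<comment> \<open>The value at \<open>t\<close> involves the edges with indices
    \<open>\<lfloor>t\<rfloor>\<close> and \<open>\<lfloor>t\<rfloor> + 1\<close>, hence the extra
    1.\<close>
  have "\<bar>\<lfloor>t\<rfloor>\<bar> \<le> int n + 1" "\<bar>\<lfloor>t\<rfloor> + 1\<bar> \<le> int n + 1" using assms(2) by linarith+
  then show ?thesis using assms(1) by (simp add: edge_line_def affine_line_def)
qed

text \<open>A compact set of parameters is bounded, and edge lines agreeing on a large enough window
  coincide there, so a subbasic condition cannot separate them.\<close>

lemma compact_open_determined_by_window:
  assumes T: "tree X" and W: "openin (compact_open_topology (realization X)) W"
    and f: "f \<in> reduced_lines X" "edge_line X f \<in> W"
  shows "\<exists>n. \<forall>f'\<in>reduced_lines X. (\<forall>i. \<bar>i\<bar> \<le> int n \<longrightarrow> f' i = f i) \<longrightarrow> edge_line X f' \<in> W"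
proof -
  let ?B = "{{g. continuous_map euclidean (realization X) g \<and> g ` K \<subseteq> U} | (K :: real set) U.
    compact K \<and> openin (realization X) U}"
  have "generate_topology_on ?B W"
    using W unfolding compact_open_topology_def openin_topology_generated_by_iff .
  then show ?thesis using f
  proof (induction arbitrary: f)
    case (Int a b)
    obtain m where "\<forall>f'\<in>reduced_lines X. (\<forall>i. \<bar>i\<bar> \<le> int m \<longrightarrow> f' i = f i) \<longrightarrow> edge_line X f' \<in> a"
      using Int.IH(1) Int.prems by blast
    moreover obtain n where "\<forall>f'\<in>reduced_lines X. (\<forall>i. \<bar>i\<bar> \<le> int n \<longrightarrow> f' i = f i) \<longrightarrow> edge_line X f' \<in> b"
      using Int.IH(2) Int.prems by blast
    ultimately show ?case by (intro exI[of _ "max m n"]) auto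
  next
    case (UN K)
    then obtain k where k: "k \<in> K" "edge_line X f \<in> k" by blast
    then show ?case using UN.IH[OF k(1) UN.prems(1) k(2)] by blast
  next
    case (Basis s)
    then obtain K :: "real set" and U where s: "s = {g. continuous_map euclidean (realization X) g \<and> g ` K \<subseteq> U}"
      and K: "compact K" by blast
    obtain b where b: "\<And>t. t \<in> K \<Longrightarrow> norm t \<le> b"
      using compact_imp_bounded[OF K] by (auto simp: bounded_iff)
    obtain n where n: "b \<le> real n" using real_arch_simple by blast
    have "edge_line X f' \<in> s"
      if f': "f' \<in> reduced_lines X" "\<forall>i. \<bar>i\<bar> \<le> int (n + 1) \<longrightarrow> f' i = f i" for f'
    proof -
      have "edge_line X f' t = edge_line X f t" if "t \<in> K" for t
        using b[OF that] n f'(2) by (intro edge_line_cong[of n]) auto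
      then show ?thesis
        using Basis.prems continuous_edge_line[OF T f'(1)] by (auto simp: s)
    qed
    then show ?case by blast
  qed simp
qed

lemma openin_compact_open_point:
  assumes "openin Y U"
  shows "openin (compact_open_topology Y) {g. continuous_map euclidean Y g \<and> g t \<in> U}"
proof -
  have "{g. continuous_map euclidean Y g \<and> g t \<in> U} = {g. continuous_map euclidean Y g \<and> g ` {t} \<subseteq> U}"
    by auto
  moreover have "openin (compact_open_topology Y) {g. continuous_map euclidean Y g \<and> g ` {t} \<subseteq> U}"
    unfolding compact_open_topology_def openin_topology_generated_by_iff
    by (rule generate_topology_on.Basis, rule CollectI, rule exI[of _ "{t}"], rule exI[of _ U])
      (simp add: assms)
  ultimately show ?thesis by simp
qed

text \<open>Geodesics take vertices to vertices at integer times, so membership in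
  \<open>open_star\<close> neighbourhoods at finitely many integers pins these vertices exactly, and
  with them the edges in between. The compact-open topology thus becomes that of edge
  sequences.\<close>

lemma openin_geodesics:
  assumes T: "tree X"
  shows "openin (geodesics X) W \<longleftrightarrow> W \<subseteq> topspace (geodesics X) \<and>
    (\<forall>f\<in>reduced_lines X. edge_line X f \<in> W \<longrightarrow>
      (\<exists>n. \<forall>f'\<in>reduced_lines X. (\<forall>i. \<bar>i\<bar> \<le> int n \<longrightarrow> f' i = f i) \<longrightarrow> edge_line X f' \<in> W))"
    (is "_ \<longleftrightarrow> ?R")
proof
  assume W: "openin (geodesics X) W"
  then obtain V where V: "openin (compact_open_topology (realization X)) V"
    "W = V \<inter> {f. simplicial_line X f \<and> inj f}"
    unfolding geodesics_def openin_subtopology by blast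
  have "edge_line X f \<in> W \<longleftrightarrow> edge_line X f \<in> V" if "f \<in> reduced_lines X" for f
    using edge_line_in_geodesics[OF T that] by (auto simp: V topspace_geodesics)
  then show ?R
    using openin_subset[OF W] compact_open_determined_by_window[OF T V(1)] by simp
next
  assume R: ?R
  show "openin (geodesics X) W"
    unfolding openin_subopen[of _ W]
  proof
    fix g assume g: "g \<in> W"
    then obtain f where f: "f \<in> reduced_lines X" "g = edge_line X f"
      using R geodesic_is_edge_line[OF T] by blast
    obtain n where n: "\<And>f'. f' \<in> reduced_lines X \<Longrightarrow> (\<And>i. \<bar>i\<bar> \<le> int n \<Longrightarrow> f' i = f i) \<Longrightarrow> edge_line X f' \<in> W"
      using R g f by metis
    define N where "N = (\<lambda>i::int. {h. continuous_map euclidean (realization X) h \<and>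
        h (real_of_int i) \<in> {x \<in> topspace (realization X). x (origin X (f i)) > 1/2}})"
    \<comment> \<open>The edge with index \<open>n\<close> needs its end point too, which is the
      origin at \<open>n + 1\<close>.\<close>
    define M where "M = (\<Inter>i\<in>{- int n..int n + 1}. N i) \<inter> {f. simplicial_line X f \<and> inj f}"
    have "openin (compact_open_topology (realization X)) (\<Inter>i\<in>{- int n..int n + 1}. N i)"
    proof (rule openin_Inter)
      fix V assume "V \<in> N ` {- int n..int n + 1}"
      then obtain i where V: "V = N i" by blast
      show "openin (compact_open_topology (realization X)) V"
        unfolding V N_def by (rule openin_compact_open_point[OF open_star])
    qed simp_all
    then have "openin (geodesics X) M"
      unfolding M_def geodesics_def by (rule openin_subtopology_Int)
    then have M: "M \<subseteq> topspace (geodesics X)" by (rule openin_subset)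
    have inN: "edge_line X f' \<in> N i \<longleftrightarrow> origin X (f' i) = origin X (f i)" if "f' \<in> reduced_lines X" for f' i
    proof -
      have "continuous_map euclidean (realization X) (edge_line X f')"
        using that by (rule continuous_edge_line[OF T])
      moreover from this have "edge_line X f' (of_int i) \<in> topspace (realization X)"
        by (auto simp: continuous_map_def)
      ultimately show ?thesis
        unfolding N_def by (auto simp: edge_line_def affine_line_of_int) (auto simp: vertex_point_def split: if_splits)
    qed
    have "g \<in> M" using f edge_line_in_geodesics[OF T f(1)] by (simp add: M_def inN topspace_geodesics)
    moreover have "M \<subseteq> W"
    proof
      fix h assume h: "h \<in> M"
      then obtain f' where f': "f' \<in> reduced_lines X" "h = edge_line X f'"
        using geodesic_is_edge_line[OF T] M by blast
      have o: "origin X (f' i) = origin X (f i)" if "- int n \<le> i" "i \<le> int n + 1" for i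
        using h that inN[OF f'(1)] by (auto simp: M_def f'(2))
      have "f' i = f i" if "\<bar>i\<bar> \<le> int n" for i
        using that o[of i] o[of "i + 1"] by (intro edge_eq_if_endpoints_eq[OF T f'(1) f(1)]) auto
      then show "h \<in> W" using n f' by simp
    qed
    ultimately show "\<exists>M. openin (geodesics X) M \<and> g \<in> M \<and> M \<subseteq> W"
      using \<open>openin (geodesics X) M\<close> by blast
  qed
qed

text \<open>\<open>q\<close> and \<open>p\<close> have the same fibres, and both target topologies
  are the quotient topologies of \<open>X\<close>; the induced bijection therefore matches open
  sets.\<close>

lemma homeomorphic_map_quotient_topology:
  assumes p: "quotient_map X Y p"
    and fibres: "\<And>x x'. x \<in> topspace X \<Longrightarrow> x' \<in> topspace X \<Longrightarrow> q x = q x' \<longleftrightarrow> p x = p x'"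
    and \<theta>: "\<And>x. x \<in> topspace X \<Longrightarrow> \<theta> (q x) = p x"
  shows "topspace (quotient_topology X q) = q ` topspace X"
    and "homeomorphic_map (quotient_topology X q) Y \<theta>"
proof -
  have "{x \<in> topspace X. q x \<in> q ` topspace X} = topspace X" by blast
  then have "openin (quotient_topology X q) (q ` topspace X)"
    by (simp add: openin_quotient_topology)
  then show top: "topspace (quotient_topology X q) = q ` topspace X"
    using openin_quotient_topology[of X q "topspace (quotient_topology X q)"]
    by (simp add: openin_subset subset_antisym)
  have "openin (quotient_topology X q) {c \<in> q ` topspace X. \<theta> c \<in> U} \<longleftrightarrow> openin Y U"
    if U: "U \<subseteq> topspace Y" for U
  proof -
    have "{x \<in> topspace X. q x \<in> {c \<in> q ` topspace X. \<theta> c \<in> U}} = {x \<in> topspace X. p x \<in> U}"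
      by (intro Collect_cong conj_cong refl) (simp add: \<theta>)
    then show ?thesis using p U by (auto simp: openin_quotient_topology quotient_map_def)
  qed
  moreover have "\<theta> ` q ` topspace X = topspace Y"
    using quotient_imp_surjective_map[OF p] by (auto simp: \<theta> image_image)
  moreover have "inj_on \<theta> (q ` topspace X)"
    by (auto simp: inj_on_def \<theta> fibres)
  ultimately show "homeomorphic_map (quotient_topology X q) Y \<theta>"
    by (simp add: homeomorphic_map_def quotient_map_def top)
qed

section \<open>The conjugacy\<close>

context lifted_action
begin

text \<open>\<open>realize_aut\<close> is linear in the coordinates; pulling them back along the
  inverse of \<open>fst g\<close> moves the point of a vertex to the point of its image.\<close>

lemma realize_aut_edge_line:
  assumes g: "g \<in> carrier G" and f: "f \<in> reduced_lines T"
  shows "realize_aut T g \<circ> edge_line T f = edge_line T (\<lambda>i. snd g (f i))"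
proof (intro ext)
  fix t w
  have v: "origin T (f i) \<in> verts T" for i using reduced_linesD(1)[OF f] by simp
  have point: "(if w \<in> verts T then vertex_point v (inv_into (verts T) (fst g) w) else 0) = vertex_point (fst g v) w"
    if "v \<in> verts T" for v
  proof (cases "w \<in> verts T")
    case True
    then have "inv_into (verts T) (fst g) w = v \<longleftrightarrow> w = fst g v"
      using V.inj_prop[OF g] V.surj_prop[OF g] that by (metis f_inv_into_f inv_into_f_f)
    then show ?thesis using True by (simp add: vertex_point_def)
  next
    case False
    then have "w \<noteq> fst g v" using that g by auto
    then show ?thesis using False by (simp add: vertex_point_def)
  qed
  show "(realize_aut T g \<circ> edge_line T f) t w = edge_line T (\<lambda>i. snd g (f i)) t w"
    using point[OF v, of "\<lfloor>t\<rfloor>"] point[OF v, of "\<lfloor>t\<rfloor> + 1"] reduced_linesD(1)[OF f] g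
    by (simp add: realize_aut_def edge_line_def affine_line_def split: if_splits)
qed

lemma geodesic_orbit_edge_line:
  assumes f: "f \<in> reduced_lines T"
  shows "geodesic_orbit T \<Gamma> (edge_line T f) = (\<lambda>g. edge_line T (\<lambda>i. snd g (f i))) ` carrier G"
proof -
  have "geodesic_orbit T \<Gamma> (edge_line T f) = (\<lambda>g. realize_aut T g \<circ> edge_line T f) ` carrier G"
    unfolding geodesic_orbit_def orbit_def by blast
  also have "\<dots> = (\<lambda>g. edge_line T (\<lambda>i. snd g (f i))) ` carrier G"
    by (intro image_cong refl realize_aut_edge_line f)
  finally show ?thesis .
qed

lemma code_eq_iff_translate:
  assumes k: "k \<ge> 1" and acyl: "acylindrical k T \<Gamma>"
    and f: "f \<in> reduced_lines T" "f' \<in> reduced_lines T"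
  shows "code k f = code k f' \<longleftrightarrow> (\<exists>g \<in> carrier G. f' = (\<lambda>i. snd g (f i)))"
proof
  assume eq: "code k f = code k f'"
  obtain g where g: "g \<in> carrier G" "moves k g f f' 0"
    using code_eq_imp_moves[OF f] eq by metis
  have "snd g (f i) = f' i" for i
    using code_eq_imp_translate[OF k acyl f g, of "nat \<bar>i\<bar>" i] eq by simp
  then have "f' = (\<lambda>i. snd g (f i))" by simp
  then show "\<exists>g \<in> carrier G. f' = (\<lambda>i. snd g (f i))" using g(1) by blast
qed (use code_act f in force)

lemma geodesic_orbit_eq_iff:
  assumes T: "tree T" and k: "k \<ge> 1" and acyl: "acylindrical k T \<Gamma>"
    and f: "f \<in> reduced_lines T" "f' \<in> reduced_lines T"
  shows "geodesic_orbit T \<Gamma> (edge_line T f) = geodesic_orbit T \<Gamma> (edge_line T f')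
    \<longleftrightarrow> code k f = code k f'"
proof
  assume eq: "geodesic_orbit T \<Gamma> (edge_line T f) = geodesic_orbit T \<Gamma> (edge_line T f')"
  have "edge_line T (\<lambda>i. snd \<one>\<^bsub>G\<^esub> (f' i)) \<in> geodesic_orbit T \<Gamma> (edge_line T f')"
    unfolding geodesic_orbit_edge_line[OF f(2)] by (rule imageI) simp
  moreover have "(\<lambda>i. snd \<one>\<^bsub>G\<^esub> (f' i)) = f'" using reduced_linesD(1)[OF f(2)] by simp
  ultimately have "edge_line T f' \<in> geodesic_orbit T \<Gamma> (edge_line T f)" using eq by simp
  then obtain g where g: "g \<in> carrier G" "edge_line T f' = edge_line T (\<lambda>i. snd g (f i))"
    unfolding geodesic_orbit_edge_line[OF f(1)] by blast
  then have "f' = (\<lambda>i. snd g (f i))"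
    using edge_line_eqD[OF T f(2) reduced_lines_act[OF f(1) g(1)]] by blast
  then show "code k f = code k f'" using g(1) code_eq_iff_translate[OF k acyl f] by blast
next
  have sub: "geodesic_orbit T \<Gamma> (edge_line T f') \<subseteq> geodesic_orbit T \<Gamma> (edge_line T f)"
    if f: "f \<in> reduced_lines T" "f' \<in> reduced_lines T" and eq: "code k f = code k f'" for f f'
  proof
    fix c assume "c \<in> geodesic_orbit T \<Gamma> (edge_line T f')"
    then obtain h where h: "h \<in> carrier G" "c = edge_line T (\<lambda>i. snd h (f' i))"
      unfolding geodesic_orbit_edge_line[OF f(2)] by blast
    obtain g where g: "g \<in> carrier G" "f' = (\<lambda>i. snd g (f i))"
      using eq code_eq_iff_translate[OF k acyl f] by blast
    have "c = edge_line T (\<lambda>i. snd (h \<cdot> g) (f i))" "h \<cdot> g \<in> carrier G"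
      using g h reduced_linesD(1)[OF f(1)] by simp_all
    then show "c \<in> geodesic_orbit T \<Gamma> (edge_line T f)"
      unfolding geodesic_orbit_edge_line[OF f(1)] by blast
  qed
  assume "code k f = code k f'"
  then show "geodesic_orbit T \<Gamma> (edge_line T f) = geodesic_orbit T \<Gamma> (edge_line T f')"
    using sub f by (metis subset_antisym)
qed

text \<open>Codes are defined on edge sequences, geodesics are real maps; \<open>edge_line\<close>
  is injective on reduced lines of a tree and can be inverted there.\<close>

definition geodesic_code where
  "geodesic_code k = code k \<circ> the_inv_into (reduced_lines T) (edge_line T)"

lemma geodesic_code_edge_line:
  assumes "tree T" "f \<in> reduced_lines T"
  shows "geodesic_code k (edge_line T f) = code k f"
proof -
  have "inj_on (edge_line T) (reduced_lines T)"
    using edge_line_eqD[OF assms(1)] by (blast intro: inj_onI)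
  then show ?thesis using assms(2) by (simp add: geodesic_code_def the_inv_into_f_f)
qed

lemma quotient_map_geodesic_code:
  assumes T: "tree T" and k: "k \<ge> 1" and acyl: "acylindrical k T \<Gamma>"
  shows "quotient_map (geodesics T)
    (subtopology (full_shift (flow_alphabet k X)) (geodesic_flow k X)) (geodesic_code k)"
proof (rule continuous_open_imp_quotient_map)
  let ?Y = "subtopology (full_shift (flow_alphabet k X)) (geodesic_flow k X)"
  note gc = geodesic_code_edge_line[OF T]
  note open_geo = openin_geodesics[OF T]
  note open_flow = openin_subshift[OF geodesic_flow_in_full_shift]
  have topY: "topspace ?Y = geodesic_flow k X"
    using geodesic_flow_in_full_shift by (auto simp del: X_simps)
  have lines: "g \<in> topspace (geodesics T) \<longleftrightarrow> (\<exists>f\<in>reduced_lines T. g = edge_line T f)" for g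
    using geodesic_is_edge_line[OF T] edge_line_in_geodesics[OF T] by metis
  show surj: "geodesic_code k ` topspace (geodesics T) = topspace ?Y"
  proof (intro equalityI subsetI)
    fix s assume "s \<in> geodesic_code k ` topspace (geodesics T)"
    then obtain f where "f \<in> reduced_lines T" "s = code k f" using lines gc by auto
    then show "s \<in> topspace ?Y" unfolding topY using code_in_flow[OF k] by blast
  next
    fix s assume "s \<in> topspace ?Y"
    then obtain f where f: "f \<in> reduced_lines T" "code k f = s"
      using code_onto_flow[OF k] unfolding topY by blast
    then have "geodesic_code k (edge_line T f) = s" by (simp add: gc)
    then show "s \<in> geodesic_code k ` topspace (geodesics T)"
      using edge_line_in_geodesics[OF T f(1)] by blast
  qed
  show "continuous_map (geodesics T) ?Y (geodesic_code k)"
    unfolding continuous_map_def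
  proof (intro conjI allI impI)
    show "geodesic_code k \<in> topspace (geodesics T) \<rightarrow> topspace ?Y" using surj by blast
    fix U assume U: "openin ?Y U"
    show "openin (geodesics T) {g \<in> topspace (geodesics T). geodesic_code k g \<in> U}"
      unfolding open_geo
    proof (intro conjI ballI impI)
      fix f assume f: "f \<in> reduced_lines T"
        and "edge_line T f \<in> {g \<in> topspace (geodesics T). geodesic_code k g \<in> U}"
      then have "code k f \<in> U" by (simp add: gc)
      then obtain n where n: "\<And>s'. s' \<in> geodesic_flow k X \<Longrightarrow> (\<And>i. \<bar>i\<bar> \<le> int n \<Longrightarrow> s' i = code k f i) \<Longrightarrow> s' \<in> U"
        using U unfolding open_flow by meson
      have "edge_line T f' \<in> {g \<in> topspace (geodesics T). geodesic_code k g \<in> U}"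
        \<comment> \<open>Letter \<open>i\<close> looks back to the edge with index
          \<open>i - k\<close>, so the radius grows by \<open>k\<close>.\<close>
        if f': "f' \<in> reduced_lines T" "\<forall>i. \<bar>i\<bar> \<le> int (n + k) \<longrightarrow> f' i = f i" for f'
      proof -
        have "code k f' i = code k f i" if "\<bar>i\<bar> \<le> int n" for i
          using that f'(2) by (intro code_window_cong) auto
        then have "code k f' \<in> U" using n code_in_flow[OF k f'(1)] by blast
        then show ?thesis using edge_line_in_geodesics[OF T f'(1)] by (simp add: gc f'(1))
      qed
      then show "\<exists>n. \<forall>f'\<in>reduced_lines T. (\<forall>i. \<bar>i\<bar> \<le> int n \<longrightarrow> f' i = f i) \<longrightarrow>
          edge_line T f' \<in> {g \<in> topspace (geodesics T). geodesic_code k g \<in> U}" by blast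
    qed blast
  qed
  show "open_map (geodesics T) ?Y (geodesic_code k)"
    unfolding open_map_def
  proof (intro allI impI)
    fix W assume W: "openin (geodesics T) W"
    have Wsub: "W \<subseteq> topspace (geodesics T)" using W by (rule openin_subset)
    show "openin ?Y (geodesic_code k ` W)"
      unfolding open_flow
    proof (intro conjI ballI)
      show "geodesic_code k ` W \<subseteq> geodesic_flow k X" using surj Wsub topY by blast
      fix s assume "s \<in> geodesic_code k ` W"
      then obtain g where "g \<in> W" "s = geodesic_code k g" by blast
      moreover from this(1) obtain f where "f \<in> reduced_lines T" "g = edge_line T f"
        using Wsub lines by blast
      ultimately have "\<exists>f\<in>reduced_lines T. edge_line T f \<in> W \<and> s = code k f"
        using gc by auto
      then obtain f where f: "f \<in> reduced_lines T" "edge_line T f \<in> W" "s = code k f"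
        by blast
      then obtain n where n: "\<And>f'. f' \<in> reduced_lines T \<Longrightarrow> (\<And>i. \<bar>i\<bar> \<le> int n \<Longrightarrow> f' i = f i) \<Longrightarrow> edge_line T f' \<in> W"
        using W unfolding open_geo by meson
      have "s' \<in> geodesic_code k ` W"
        if s': "s' \<in> geodesic_flow k X" "\<forall>i. \<bar>i\<bar> \<le> int n \<longrightarrow> s' i = s i" for s'
      proof -
        obtain f' where f': "f' \<in> reduced_lines T" "code k f' = s'"
          using code_onto_flow[OF k s'(1)] by blast
        have eq: "code k f' i = code k f i" if "\<bar>i\<bar> \<le> int n" for i
          using that s'(2) f' f by simp
        \<comment> \<open>The line to be moved is \<open>f'\<close>: its translate lies near
          \<open>f\<close>, hence in \<open>W\<close>, and keeps the code \<open>s'\<close>.\<close>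
        obtain g where g: "g \<in> carrier G" "moves k g f' f 0"
          using code_eq_imp_moves[OF f'(1) f(1) eq[of 0]] by auto
        have "snd g (f' i) = f i" if "\<bar>i\<bar> \<le> int n" for i
          using code_eq_imp_translate[OF k acyl f'(1) f(1) g eq that] .
        then have "edge_line T (\<lambda>i. snd g (f' i)) \<in> W"
          by (intro n reduced_lines_act[OF f'(1) g(1)])
        moreover have "geodesic_code k (edge_line T (\<lambda>i. snd g (f' i))) = s'"
          using gc[OF reduced_lines_act[OF f'(1) g(1)]] code_act[OF f'(1) g(1)] f'(2) by simp
        ultimately show ?thesis by (metis imageI)
      qed
      then show "\<exists>n. \<forall>s'\<in>geodesic_flow k X. (\<forall>i. \<bar>i\<bar> \<le> int n \<longrightarrow> s' i = s i) \<longrightarrow> s' \<in> geodesic_code k ` W"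
        by blast
    qed
  qed
qed

lemma edge_line_shift: "edge_line T (\<lambda>i. f (i + 1)) = (\<lambda>t. edge_line T f (t + 1))"
  unfolding edge_line_def by (rule ext) (rule affine_line_shift)

lemma reduced_lines_shift: "f \<in> reduced_lines T \<Longrightarrow> (\<lambda>i. f (i + 1)) \<in> reduced_lines T"
  using reduced_linesD[of f T] unfolding reduced_lines_def by blast

lemma geodesic_transformation_orbit:
  assumes f: "f \<in> reduced_lines T"
  shows "geodesic_transformation (geodesic_orbit T \<Gamma> (edge_line T f))
    = geodesic_orbit T \<Gamma> (edge_line T (\<lambda>i. f (i + 1)))"
  unfolding geodesic_transformation_def geodesic_orbit_edge_line[OF f]
    geodesic_orbit_edge_line[OF reduced_lines_shift[OF f]] image_image
  by (intro image_cong refl) (rule edge_line_shift[symmetric])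

theorem quotient_geodesic_flow_conjugacy:
  assumes T: "tree T" and k: "k \<ge> 1" and acyl: "acylindrical k T \<Gamma>"
  shows "\<exists>\<theta>. homeomorphic_map (geodesics_quotient T \<Gamma>)
              (subtopology (full_shift (flow_alphabet k X)) (geodesic_flow k X)) \<theta>
          \<and> (\<forall>c \<in> topspace (geodesics_quotient T \<Gamma>).
                \<theta> (geodesic_transformation c) = left_shift (\<theta> c))"
proof -
  let ?q = "geodesic_orbit T \<Gamma>"
  \<comment> \<open>An arbitrary representative of the orbit is coded; \<open>fibres\<close> makes
    the result independent of it.\<close>
  define \<theta> where "\<theta> = geodesic_code k \<circ> inv_into (topspace (geodesics T)) ?q"
  note gc = geodesic_code_edge_line[OF T]
  have fibres: "?q x = ?q y \<longleftrightarrow> geodesic_code k x = geodesic_code k y"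
    if xy: "x \<in> topspace (geodesics T)" "y \<in> topspace (geodesics T)" for x y
  proof -
    obtain f f' where f: "f \<in> reduced_lines T" "x = edge_line T f" "f' \<in> reduced_lines T" "y = edge_line T f'"
      using geodesic_is_edge_line[OF T] xy by metis
    then show ?thesis using geodesic_orbit_eq_iff[OF T k acyl f(1,3)] by (simp add: gc)
  qed
  have \<theta>: "\<theta> (?q x) = geodesic_code k x" if x: "x \<in> topspace (geodesics T)" for x
  proof -
    have "?q x \<in> ?q ` topspace (geodesics T)" using x by (rule imageI)
    then have "inv_into (topspace (geodesics T)) ?q (?q x) \<in> topspace (geodesics T)"
      "?q (inv_into (topspace (geodesics T)) ?q (?q x)) = ?q x"
      by (rule inv_into_into, rule f_inv_into_f)
    then show ?thesis using fibres x by (simp add: \<theta>_def)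
  qed
  have top: "topspace (geodesics_quotient T \<Gamma>) = ?q ` topspace (geodesics T)"
    and homeo: "homeomorphic_map (geodesics_quotient T \<Gamma>)
      (subtopology (full_shift (flow_alphabet k X)) (geodesic_flow k X)) \<theta>"
    unfolding geodesics_quotient_def
    using homeomorphic_map_quotient_topology[OF quotient_map_geodesic_code[OF T k acyl], of ?q \<theta>]
      fibres \<theta> by blast+
  have "\<theta> (geodesic_transformation c) = left_shift (\<theta> c)"
    if c: "c \<in> topspace (geodesics_quotient T \<Gamma>)" for c
  proof -
    obtain x where "x \<in> topspace (geodesics T)" "c = ?q x"
      using c unfolding top by blast
    then obtain f where f: "f \<in> reduced_lines T" "c = ?q (edge_line T f)"
      using geodesic_is_edge_line[OF T] by metis
    note sh = reduced_lines_shift[OF f(1)]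
    show ?thesis
      using f sh edge_line_in_geodesics[OF T]
      by (simp add: geodesic_transformation_orbit \<theta> gc code_shift)
  qed
  then show ?thesis using homeo by blast
qed

end

theorem mainTheorem4:
  fixes T :: "('v, 'e) serre_graph"
    and \<Gamma> :: "(('v \<Rightarrow> 'v) \<times> ('e \<Rightarrow> 'e)) set"
    and k :: nat
    and liftv :: "'v set \<Rightarrow> 'v"
    and lifte :: "'e set \<Rightarrow> 'e"
    and gel :: "'e set \<Rightarrow> ('v \<Rightarrow> 'v) \<times> ('e \<Rightarrow> 'e)"
  assumes "k \<ge> 1"
    and "tree T"
    and "subgroup \<Gamma> (graph_aut T)"
    and "without_inversion T \<Gamma>"
    and "acylindrical k T \<Gamma>"
    and "lift_choice T \<Gamma> liftv lifte gel"
    and "X = quotient_graph_of_groups T \<Gamma> liftv lifte gel"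
  shows "subshift (flow_alphabet k X) (geodesic_flow k X)
    \<and> (\<exists>\<theta>. homeomorphic_map (geodesics_quotient T \<Gamma>)
              (subtopology (full_shift (flow_alphabet k X)) (geodesic_flow k X)) \<theta>
          \<and> (\<forall>c \<in> topspace (geodesics_quotient T \<Gamma>).
                \<theta> (geodesic_transformation c) = left_shift (\<theta> c)))"
proof -
  interpret lifted_action T \<Gamma> liftv lifte gel
    using assms by (intro lifted_action.intro) (simp_all add: tree_def)
  show ?thesis
    unfolding assms(7)
    using subshift_geodesic_flow quotient_geodesic_flow_conjugacy assms(1,2,5) by blast
qed

end
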